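(* Let $n\ge 1$, $n<p<\infty$, and let $\rho$ be an admissible measure on $\mathbb{R}^n$. Suppose $S\in\mathcal{S}(n)$ and set $\mu=S_\#\rho$. Further suppose $u\in\mathcal{D}^{1,p}(\mathbb{R}^n)$ is an extremal with $$[u]_\rho=\frac{\left|\int_{\mathbb{R}^n}u(x)\,d\mu(x)\right|}{\left|\int_{\mathbb{R}^n}x\,d\mu(x)\right|^{1-n/p}}.$$ Then $$\inf_{\mathbb{R}^n}u=\min_{\mathrm{supp}(\mu)}u\quad\text{and}\quad\sup_{\mathbb{R}^n}u=\max_{\mathrm{supp}(\mu)}u.$$
   Context: $\mathcal{D}^{1,p}(\mathbb{R}^n)$ is the space of $u\in L^1_{\rm loc}(\mathbb{R}^n)$ whose weak partial derivatives $u_{x_i}$, $i=1,\dots,n$, all belong to $L^p(\mathbb{R}^n)$. Since $p>n$, each $u$ is identified with its $(1-n/p)$-Hölder continuous representative. $\|Du\|_p:=\left(\int_{\mathbb{R}^n}|Du|^p\,dx\right)^{1/p}$. An admissible measure is a signed Borel measure $\rho$ on $\mathbb{R}^n$ with compact support, $\rho(\mathbb{R}^n)=0$, and $\int_{\mathbb{R}^n}y\,d\rho(y)\ne 0$. $\mathcal{S}(n)$ is the set of similarity transformations $S(y)=\lambda Oy+z$ of $\mathbb{R}^n$ with $\lambda>0$, $O\in\mathrm{O}(n)$, $z\in\mathbb{R}^n$. The push forward is $(S_\#\rho)(A)=\rho(S^{-1}(A))$ for Borel $A\subset\mathbb{R}^n$. For $u\in\mathcal{D}^{1,p}(\mathbb{R}^n)$,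 $$[u]_\rho:=\sup\left\{\frac{\left|\int u\,d\mu\right|}{\left|\int x\,d\mu(x)\right|^{1-n/p}}:\ \mu=S_\#\rho,\ S\in\mathcal{S}(n)\right\}.$$ $C_*$ is the smallest constant $C$ such that the generalized Morrey inequality $[u]_\rho\le C\|Du\|_p$ holds for all $u\in\mathcal{D}^{1,p}(\mathbb{R}^n)$. An extremal is a $u\in\mathcal{D}^{1,p}(\mathbb{R}^n)$ with $[u]_\rho=C_*\|Du\|_p$. *)

theory Defs
  imports "HOL-Analysis.Analysis"
begin

section \<open>Signed Borel measures\<close>

text \<open>A signed Borel measure is a real-valued set function; only its values on Borel sets matter.
  Infinite values are excluded without loss of generality, since the measures considered here
  have finite total mass \<^term>\<open>0\<close>, which forces every value to be finite.\<close>

definition signed_borel_measure :: "('a::topological_space set \<Rightarrow> real) \<Rightarrow> bool" where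
  "signed_borel_measure \<rho> \<longleftrightarrow>
     \<rho> {} = 0 \<and>
     (\<forall>A::nat \<Rightarrow> 'a set. range A \<subseteq> sets borel \<longrightarrow> disjoint_family A \<longrightarrow>
        (\<lambda>k. \<rho> (A k)) sums \<rho> (\<Union>k. A k))"

text \<open>The positive and negative variations of the Jordan decomposition,
  \<open>\<rho>\<^sup>+(A) = sup {\<rho>(B) : B \<subseteq> A Borel}\<close> and \<open>\<rho>\<^sup>- = (-\<rho>)\<^sup>+\<close>. The truncation of negative
  values by \<^const>\<open>ennreal\<close> is harmless, because \<open>B = {}\<close> contributes \<open>0\<close>.\<close>

definition pos_variation :: "('a::topological_space set \<Rightarrow> real) \<Rightarrow> 'a measure" where
  "pos_variation \<rho> =
     measure_of UNIV (sets borel) (\<lambda>A. SUP B \<in> {B \<in> sets borel. B \<subseteq> A}. ennreal (\<rho> B))"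

definition neg_variation :: "('a::topological_space set \<Rightarrow> real) \<Rightarrow> 'a measure" where
  "neg_variation \<rho> = pos_variation (\<lambda>A. - \<rho> A)"

definition signed_integral ::
  "('a::topological_space set \<Rightarrow> real) \<Rightarrow> ('a \<Rightarrow> 'b) \<Rightarrow> 'b::{banach, second_countable_topology}" where
  "signed_integral \<rho> f = integral\<^sup>L (pos_variation \<rho>) f - integral\<^sup>L (neg_variation \<rho>) f"

text \<open>The support of the total variation \<open>|\<rho>| = \<rho>\<^sup>+ + \<rho>\<^sup>-\<close>.\<close>

definition signed_support :: "('a::topological_space set \<Rightarrow> real) \<Rightarrow> 'a set" where
  "signed_support \<rho> =
     {x. \<forall>U. open U \<longrightarrow> x \<in> U \<longrightarrow> emeasure (pos_variation \<rho>) U + emeasure (neg_variation \<rho>) U \<noteq> 0}"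

definition admissible_measure :: "((real^'n) set \<Rightarrow> real) \<Rightarrow> bool" where
  "admissible_measure \<rho> \<longleftrightarrow>
     signed_borel_measure \<rho> \<and> compact (signed_support \<rho>) \<and> \<rho> UNIV = 0 \<and>
     signed_integral \<rho> (\<lambda>y. y) \<noteq> 0"

definition similarities :: "(real^'n \<Rightarrow> real^'n) set" where
  "similarities =
     {\<lambda>y. c *\<^sub>R (Q *v y) + z | (c::real) (Q::real^'n^'n) z. c > 0 \<and> orthogonal_matrix Q}"

definition push_forward :: "('a \<Rightarrow> 'b) \<Rightarrow> ('a set \<Rightarrow> real) \<Rightarrow> 'b set \<Rightarrow> real" where
  "push_forward S \<rho> = (\<lambda>A. \<rho> (S -` A))"


section \<open>Weak derivatives and the homogeneous Sobolev space\<close>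

definition partial_deriv :: "'n \<Rightarrow> (real^'n \<Rightarrow> real) \<Rightarrow> real^'n \<Rightarrow> real" where
  "partial_deriv i f x = frechet_derivative f (at x) (axis i 1)"

text \<open>Smoothness: all iterated partial derivatives, of every order, are differentiable everywhere
  (and hence also continuous).\<close>

definition smooth_fun :: "(real^'n \<Rightarrow> real) \<Rightarrow> bool" where
  "smooth_fun f \<longleftrightarrow> (\<forall>is x. foldr partial_deriv is f differentiable (at x))"

definition test_function :: "(real^'n \<Rightarrow> real) \<Rightarrow> bool" where
  "test_function \<phi> \<longleftrightarrow> smooth_fun \<phi> \<and> compact (closure {x. \<phi> x \<noteq> 0})"

definition locally_integrable :: "(real^'n \<Rightarrow> real) \<Rightarrow> bool" where
  "locally_integrable u \<longleftrightarrow> (\<forall>K. compact K \<longrightarrow> set_integrable lborel K u)"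

definition is_weak_partial :: "(real^'n \<Rightarrow> real) \<Rightarrow> 'n \<Rightarrow> (real^'n \<Rightarrow> real) \<Rightarrow> bool" where
  "is_weak_partial u i v \<longleftrightarrow>
     locally_integrable v \<and>
     (\<forall>\<phi>. test_function \<phi> \<longrightarrow>
        (LINT x|lborel. u x * partial_deriv i \<phi> x) = - (LINT x|lborel. v x * \<phi> x))"

definition in_Lp :: "real \<Rightarrow> (real^'n \<Rightarrow> real) \<Rightarrow> bool" where
  "in_Lp p v \<longleftrightarrow> v \<in> borel_measurable lborel \<and> integrable lborel (\<lambda>x. \<bar>v x\<bar> powr p)"

text \<open>For \<open>p > n\<close>, every class in \<open>D\<^sup>1\<^sup>,\<^sup>p\<close> has exactly one \<open>(1 - n/p)\<close>-Hoelder continuous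
  representative; the set below consists of these representatives.\<close>

definition D1p :: "real \<Rightarrow> (real^'n \<Rightarrow> real) set" where
  "D1p p =
     {u. locally_integrable u \<and> (\<forall>i. \<exists>v. is_weak_partial u i v \<and> in_Lp p v) \<and>
         (\<exists>L. \<forall>x y. \<bar>u x - u y\<bar> \<le> L * norm (x - y) powr (1 - real CARD('n) / p))}"

text \<open>Weak partial derivatives are unique up to null sets, so the choice made here is
  immaterial for the norm below.\<close>

definition weak_grad :: "(real^'n \<Rightarrow> real) \<Rightarrow> real^'n \<Rightarrow> real^'n" where
  "weak_grad u x = (\<chi> i. (SOME v. is_weak_partial u i v) x)"

definition grad_norm :: "real \<Rightarrow> (real^'n \<Rightarrow> real) \<Rightarrow> real" where
  "grad_norm p u = (LINT x|lborel. norm (weak_grad u x) powr p) powr (1 / p)"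


section \<open>The generalized Morrey inequality\<close>

definition morrey_quotient :: "real \<Rightarrow> ((real^'n) set \<Rightarrow> real) \<Rightarrow> (real^'n \<Rightarrow> real) \<Rightarrow> real" where
  "morrey_quotient p \<mu> u =
     \<bar>signed_integral \<mu> u\<bar> /
       norm (signed_integral \<mu> (\<lambda>x. x)) powr (1 - real CARD('n) / p)"

text \<open>The seminorm and the sharp constant take values in \<open>[0, \<infinity>]\<close>, so that the supremum
  and the smallest constant make sense before they are known to be finite.\<close>

definition morrey_seminorm ::
  "real \<Rightarrow> ((real^'n) set \<Rightarrow> real) \<Rightarrow> (real^'n \<Rightarrow> real) \<Rightarrow> ennreal" where
  "morrey_seminorm p \<rho> u = (SUP S \<in> similarities. ennreal (morrey_quotient p (push_forward S \<rho>) u))"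

definition morrey_constant :: "real \<Rightarrow> ((real^'n) set \<Rightarrow> real) \<Rightarrow> ennreal" where
  "morrey_constant p \<rho> =
     (LEAST C. \<forall>u \<in> D1p p. morrey_seminorm p \<rho> u \<le> C * ennreal (grad_norm p u))"

definition morrey_extremal ::
  "real \<Rightarrow> ((real^'n) set \<Rightarrow> real) \<Rightarrow> (real^'n \<Rightarrow> real) \<Rightarrow> bool" where
  "morrey_extremal p \<rho> u \<longleftrightarrow>
     u \<in> D1p p \<and> morrey_seminorm p \<rho> u = morrey_constant p \<rho> * ennreal (grad_norm p u)"

end

theory Submission
  imports Defs
begin

text \<open>
  Put \<open>m = min\<close> of \<open>u\<close> over the support of \<open>\<mu>\<close> and \<open>w = max(u, m)\<close>. Then \<open>w = u\<close> on the support, so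
  \<open>C\<^sub>* \<parallel>Du\<parallel> = [u]\<close> equals the quotient of \<open>w\<close> at \<open>\<mu>\<close>, which is at most \<open>C\<^sub>* \<parallel>Dw\<parallel>\<close>. As truncation
  shrinks the gradient on \<open>u \<le> m\<close> and keeps it elsewhere, \<open>Du\<close> vanishes on \<open>u \<le> m\<close>; hence \<open>u - w\<close> has
  zero gradient, is constant, and vanishes on the support. The supremum is the case of \<open>-u\<close>.

  Morrey's inequality itself is not needed: a nonconstant extremal whose seminorm is attained has
  finite seminorm, which forces \<open>C\<^sub>* < \<infinity>\<close>, and \<open>C\<^sub>* > 0\<close> because some smooth compactly supported
  function has nonzero integral against \<open>\<rho>\<close>. The truncation formula for weak derivatives is obtained from
  difference quotients instead of mollification.
\<close>

section \<open>Smooth bump functions\<close>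

text \<open>A weak derivative is known only through its pairings with smooth functions, and
  \<open>max (u x) m\<close> is not smooth in \<open>u\<close>, so its gradient cannot be read off
  by substitution. What makes composition possible is an exact increment formula: for almost every
  x, \<open>u (x + a *\<^sub>R axis i 1) - u x\<close> is a times the mean of the weak derivative
  over the segment. Increments compose with a C^1 function through its divided difference, and
  translation invariance moves the shift off the derivative, which is merely locally integrable,
  onto a bounded factor. The same formula turns a vanishing gradient into constancy. Explicit smooth
  functions serve twice: they separate locally integrable functions, which makes weak derivatives
  unique, and they supply a competitor with positive seminorm. The bounds on the sharp constant
  matter because it has to be cancelled in the extended nonnegative reals, where 0 and infinity do
  not cancel.\<close>

definition flat :: "nat \<Rightarrow> real \<Rightarrow> real" where
  "flat k t = (if 0 < t then (1 / t) ^ k * exp (- (1 / t)) else 0)"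

lemma flat_tendsto_0: "(flat k \<longlongrightarrow> 0) (at 0)"
proof -
  have "((\<lambda>t. (1/t) ^ k / exp (1/t)) \<longlongrightarrow> 0) (at_right (0::real))"
    by (rule filterlim_compose[OF tendsto_power_div_exp_0])
       (simp add: filterlim_inverse_at_top_right flip: inverse_eq_divide)
  then have "(flat k \<longlongrightarrow> 0) (at_right 0)"
    by (rule Lim_transform_eventually)
       (auto simp: eventually_at_filter flat_def exp_minus field_simps)
  moreover have "(flat k \<longlongrightarrow> 0) (at_left 0)"
    by (rule Lim_transform_eventually[OF tendsto_const])
       (auto simp: eventually_at_filter flat_def)
  ultimately show ?thesis
    by (simp add: filterlim_split_at)
qed

text \<open>The index k exists for this formula: \<open>flat 0\<close> is the classical profile
  exp(-1/t) extended by 0, and the derivative of each member is a linear combination of later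
  members, so smoothness of every order follows from one computation.\<close>

lemma flat_has_derivative:
  "(flat k has_real_derivative (flat (k + 2) t - real k * flat (k + 1) t)) (at t)"
proof -
  consider "t > 0" | "t < 0" | "t = 0" by linarith
  then show ?thesis
  proof cases
    case 1
    have "((\<lambda>t. (1 / t) ^ k * exp (- (1 / t))) has_real_derivative
        (flat (k + 2) t - real k * flat (k + 1) t)) (at t)"
    proof (cases k)
      case (Suc m)
      have "((\<lambda>t. (1 / t) ^ Suc m * exp (- (1 / t))) has_real_derivative
          (real (Suc m) * (1 / t) ^ m * (- (1 / t\<^sup>2)) * exp (- (1 / t)) +
           (1 / t) ^ Suc m * (exp (- (1 / t)) * (1 / t\<^sup>2)))) (at t)"
      proof -
        have d: "((\<lambda>t. 1 / t) has_real_derivative - (1 / t\<^sup>2)) (at t)"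
          using 1 by (auto intro!: derivative_eq_intros simp: power2_eq_square)
        show ?thesis
          by (rule DERIV_cong, rule DERIV_mult[OF DERIV_power_Suc[OF d] DERIV_fun_exp[OF DERIV_minus[OF d]]])
             (simp add: algebra_simps add_divide_distrib)
      qed
      then show ?thesis
        unfolding Suc by (rule DERIV_cong) (use 1 in \<open>simp add: flat_def power2_eq_square algebra_simps add_divide_distrib\<close>)
    qed (use 1 in \<open>auto intro!: derivative_eq_intros simp: flat_def field_simps power2_eq_square\<close>)
    then show ?thesis
      by (rule has_field_derivative_transform_within_open[of _ _ _ "{0<..}"])
         (use 1 in \<open>auto simp: flat_def\<close>)
  next
    case 2
    have "((\<lambda>t. 0) has_real_derivative 0) (at t)" by simp
    then have "(flat k has_real_derivative 0) (at t)"
      by (rule has_field_derivative_transform_within_open[of _ _ _ "{..<0}"])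
         (use 2 in \<open>auto simp: flat_def\<close>)
    then show ?thesis using 2 by (simp add: flat_def)
  next
    case 3
    \<comment> \<open>For h different from 0 the quotient \<open>flat k h / h\<close> is
      \<open>flat (Suc k) h\<close>, so differentiability at 0 reduces to the limit of the next
      member of the family.\<close>
    have "((\<lambda>h. flat k h / h) \<longlongrightarrow> 0) (at 0)"
      by (rule Lim_transform_eventually[OF flat_tendsto_0[of "Suc k"]])
         (auto simp: eventually_at_filter flat_def)
    then show ?thesis using 3 by (simp add: DERIV_def flat_def)
  qed
qed

lemma flat_0_bounds: "0 \<le> flat 0 t" "flat 0 t \<le> 1"
  by (auto simp: flat_def)

text \<open>\<open>smooth_fun\<close> quantifies over partial derivatives of every order. A class of
  differentiable functions closed under a single partial derivative settles all orders by induction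
  on the list of directions; sums and products are included because the chain and product rules
  produce them.\<close>

inductive_set smooth_alg :: "(real^'n \<Rightarrow> real) set" where
  const: "(\<lambda>x. c) \<in> smooth_alg"
| coord: "(\<lambda>x. x $ i) \<in> smooth_alg"
| flat: "(\<lambda>x. flat k (c * x $ i + d)) \<in> smooth_alg"
| add: "f \<in> smooth_alg \<Longrightarrow> g \<in> smooth_alg \<Longrightarrow> (\<lambda>x. f x + g x) \<in> smooth_alg"
| mult: "f \<in> smooth_alg \<Longrightarrow> g \<in> smooth_alg \<Longrightarrow> (\<lambda>x. f x * g x) \<in> smooth_alg"

lemma smooth_alg_derivative:
  assumes "f \<in> smooth_alg"
  shows "\<exists>f'. (\<forall>x. (f has_derivative f' x) (at x)) \<and> (\<forall>j. (\<lambda>x. f' x (axis j 1)) \<in> smooth_alg)"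
  using assms
proof induction
  case (const c)
  show ?case
    by (rule exI[of _ "\<lambda>x y. 0"]) (auto intro: smooth_alg.const)
next
  case (coord i)
  show ?case
    by (rule exI[of _ "\<lambda>x y. y $ i"])
       (auto intro: smooth_alg.const bounded_linear_imp_has_derivative bounded_linear_vec_nth)
next
  case (flat k c i d)
  define D where "D t = flat (k + 2) t - real k * flat (k + 1) t" for t
  have *: "((\<lambda>x. flat k (c * x $ i + d)) has_derivative (\<lambda>y. (c * y $ i) * D (c * x $ i + d))) (at x)" for x
    by (rule has_derivative_eq_rhs, rule DERIV_compose_FDERIV[OF flat_has_derivative])
       (auto intro!: derivative_eq_intros bounded_linear_imp_has_derivative bounded_linear_vec_nth
             simp: D_def)
  have **: "(\<lambda>x. (c * axis j 1 $ i) * D (c * x $ i + d)) \<in> smooth_alg" for j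
  proof -
    have "(\<lambda>x. (c * axis j 1 $ i) * (flat (k + 2) (c * x $ i + d) + (- real k) * flat (k + 1) (c * x $ i + d)))
        \<in> smooth_alg"
      by (intro smooth_alg.mult smooth_alg.add smooth_alg.const smooth_alg.flat)
    then show ?thesis by (simp add: D_def)
  qed
  show ?case
    by (rule exI[of _ "\<lambda>x y. (c * y $ i) * D (c * x $ i + d)"]) (use * ** in blast)
next
  case (add f g)
  then obtain f' g' where
    "\<forall>x. (f has_derivative f' x) (at x)" "\<forall>j. (\<lambda>x. f' x (axis j 1)) \<in> smooth_alg"
    "\<forall>x. (g has_derivative g' x) (at x)" "\<forall>j. (\<lambda>x. g' x (axis j 1)) \<in> smooth_alg"
    by blast
  then show ?case
    by (intro exI[of _ "\<lambda>x y. f' x y + g' x y"])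
       (auto intro!: derivative_intros intro: smooth_alg.add)
next
  case (mult f g)
  then obtain f' g' where
    "\<forall>x. (f has_derivative f' x) (at x)" "\<forall>j. (\<lambda>x. f' x (axis j 1)) \<in> smooth_alg"
    "\<forall>x. (g has_derivative g' x) (at x)" "\<forall>j. (\<lambda>x. g' x (axis j 1)) \<in> smooth_alg"
    by blast
  then show ?case using mult.hyps
    by (intro exI[of _ "\<lambda>x y. f x * g' x y + f' x y * g x"])
       (auto intro!: has_derivative_mult smooth_alg.add smooth_alg.mult)
qed

lemma smooth_fun_smooth_alg:
  assumes "f \<in> smooth_alg"
  shows "smooth_fun f"
proof -
  have D: "g differentiable (at x)" "partial_deriv j g \<in> smooth_alg" if g: "g \<in> smooth_alg" for g j x
  proof -
    obtain g' where g': "\<And>x. (g has_derivative g' x) (at x)" "\<And>j. (\<lambda>x. g' x (axis j 1)) \<in> smooth_alg"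
      using smooth_alg_derivative[OF g] by blast
    show "g differentiable (at x)"
      using g'(1) by (auto simp: differentiable_def)
    have "frechet_derivative g (at x) = g' x" for x
      using frechet_derivative_at[OF g'(1)] by simp
    then show "partial_deriv j g \<in> smooth_alg"
      using g'(2)[of j] by (simp add: partial_deriv_def[abs_def])
  qed
  have "foldr partial_deriv is f \<in> smooth_alg" for "is"
    by (induction "is") (use assms D in auto)
  then show ?thesis
    using D by (auto simp: smooth_fun_def)
qed

lemma smooth_alg_prod:
  assumes "finite I" "\<And>i. i \<in> I \<Longrightarrow> f i \<in> smooth_alg"
  shows "(\<lambda>x. \<Prod>i\<in>I. f i x) \<in> smooth_alg"
  using assms by (induction I) (auto intro: smooth_alg.const smooth_alg.mult)

text \<open>The factor \<open>Suc k\<close> drives the arguments to infinity inside the box, where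
  \<open>flat 0\<close> tends to 1. The bumps thus approximate the indicator of the open box from
  below while vanishing outside it.\<close>

definition bump :: "real^'n \<Rightarrow> real^'n \<Rightarrow> nat \<Rightarrow> real^'n \<Rightarrow> real" where
  "bump a b k x =
     (\<Prod>i\<in>UNIV. flat 0 (real (Suc k) * (x $ i - a $ i)) * flat 0 (real (Suc k) * (b $ i - x $ i)))"

lemma bump_smooth_alg: "bump a b k \<in> smooth_alg"
proof -
  have "(\<lambda>x. flat 0 (real (Suc k) * x $ i + (- real (Suc k) * a $ i)) *
             flat 0 ((- real (Suc k)) * x $ i + real (Suc k) * b $ i)) \<in> smooth_alg" for i
    by (intro smooth_alg.mult smooth_alg.flat)
  then have "(\<lambda>x. flat 0 (real (Suc k) * (x $ i - a $ i)) *
             flat 0 (real (Suc k) * (b $ i - x $ i))) \<in> smooth_alg" for i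
    by (simp add: algebra_simps)
  then show ?thesis
    unfolding bump_def by (intro smooth_alg_prod) auto
qed

lemma bump_bounds: "0 \<le> bump a b k x" "bump a b k x \<le> 1"
  unfolding bump_def by (auto intro!: prod_nonneg prod_le_1 mult_le_one flat_0_bounds mult_nonneg_nonneg)

lemma bump_outside: "x \<notin> box a b \<Longrightarrow> bump a b k x = 0"
  by (auto simp: bump_def mem_box_cart flat_def zero_less_mult_iff not_less) (metis not_less)+

lemma bump_tendsto: "(\<lambda>k. bump a b k x) \<longlonglongrightarrow> indicator (box a b) x"
proof (cases "x \<in> box a b")
  case True
  have *: "(\<lambda>k. flat 0 (real (Suc k) * t)) \<longlonglongrightarrow> 1" if "t > 0" for t
  proof -
    have "(\<lambda>k. exp (- ((1 / t) * inverse (real (Suc k))))) \<longlonglongrightarrow> exp (- ((1 / t) * 0))"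
      by (intro tendsto_intros LIMSEQ_inverse_real_of_nat)
    moreover have "flat 0 (real (Suc k) * t) = exp (- ((1 / t) * inverse (real (Suc k))))" for k
      using that by (simp add: flat_def field_simps del: of_nat_Suc)
    ultimately show ?thesis by simp
  qed
  have "(\<lambda>k. bump a b k x) \<longlonglongrightarrow> (\<Prod>i\<in>(UNIV::'a set). 1 * 1)"
    unfolding bump_def using True by (intro tendsto_intros *) (auto simp: mem_box_cart)
  then show ?thesis using True by simp
qed (simp add: bump_outside)

lemma test_function_smooth_alg:
  assumes "f \<in> smooth_alg" "bounded A" "\<And>x. x \<notin> A \<Longrightarrow> f x = 0"
  shows "test_function f"
  unfolding test_function_def
proof
  show "smooth_fun f" by (rule smooth_fun_smooth_alg) fact
  have "{x. f x \<noteq> 0} \<subseteq> A" using assms(3) by auto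
  then show "compact (closure {x. f x \<noteq> 0})"
    using assms(2) bounded_subset compact_closure by blast
qed

lemma test_function_bump: "test_function (bump a b k)"
  using test_function_smooth_alg[OF bump_smooth_alg bounded_box bump_outside] .

text \<open>Cut-off coordinate functions: they will detect the nonzero first moment of an admissible
  measure.\<close>

lemma test_function_coord_bump: "test_function (\<lambda>x. x $ j * bump a b k x)"
  by (rule test_function_smooth_alg[OF smooth_alg.mult[OF smooth_alg.coord bump_smooth_alg] bounded_box[of a b]])
     (simp add: bump_outside)

section \<open>Locally integrable functions\<close>

text \<open>\<open>locally_integrable\<close> speaks only of compact sets; restrictions to growing
  balls converge pointwise and carry measurability to the whole space.\<close>

lemma locally_integrable_measurable:
  fixes v :: "real^'a \<Rightarrow> real"
  assumes "locally_integrable v"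
  shows "v \<in> borel_measurable borel"
proof (rule borel_measurable_LIMSEQ_real)
  fix x :: "real^'a"
  have "eventually (\<lambda>k. norm x \<le> real k) sequentially"
    using eventually_at_top_linorder real_arch_simple by (metis of_nat_mono order_trans)
  then have "eventually (\<lambda>k. indicator (cball 0 (real k)) x *\<^sub>R v x = v x) sequentially"
    by eventually_elim auto
  then show "(\<lambda>k. indicator (cball 0 (real k)) x *\<^sub>R v x) \<longlonglongrightarrow> v x"
    by (simp add: tendsto_eventually)
next
  fix k
  have "set_integrable lborel (cball 0 (real k)) v"
    using assms by (auto simp: locally_integrable_def)
  then show "(\<lambda>x. indicator (cball 0 (real k)) x *\<^sub>R v x) \<in> borel_measurable borel"
    unfolding set_integrable_def using borel_measurable_integrable by force
qed

lemma integrable_locally_integrable_mult: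
  assumes v: "locally_integrable v" and \<psi>: "\<psi> \<in> borel_measurable borel"
    and B: "\<And>x. \<bar>\<psi> x\<bar> \<le> B" and R: "\<And>x. R < norm x \<Longrightarrow> \<psi> x = 0"
  shows "integrable lborel (\<lambda>x. v x * \<psi> x)"
proof (rule Bochner_Integration.integrable_bound)
  have "set_integrable lborel (cball 0 R) v"
    using v by (auto simp: locally_integrable_def)
  then show "integrable lborel (\<lambda>x. B * (indicator (cball 0 R) x *\<^sub>R v x))"
    unfolding set_integrable_def by simp
  show "(\<lambda>x. v x * \<psi> x) \<in> borel_measurable lborel"
    using locally_integrable_measurable[OF v] \<psi> by simp
  have "\<bar>v x * \<psi> x\<bar> \<le> \<bar>B * (indicator (cball 0 R) x *\<^sub>R v x)\<bar>" for x
  proof (cases "R < norm x")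
    case False
    have "0 \<le> B" using B[of x] by linarith
    then show ?thesis
      using False mult_left_mono[OF B[of x], of "\<bar>v x\<bar>"] by (simp add: abs_mult mult.commute)
  qed (simp add: R)
  then show "AE x in lborel. norm (v x * \<psi> x) \<le> norm (B * (indicator (cball 0 R) x *\<^sub>R v x))"
    by simp
qed

lemma locally_integrable_mult_bounded:
  fixes v :: "real^'a \<Rightarrow> real"
  assumes v: "locally_integrable v" and \<psi>: "\<psi> \<in> borel_measurable borel"
    and B: "\<And>x. \<bar>\<psi> x\<bar> \<le> B"
  shows "locally_integrable (\<lambda>x. v x * \<psi> x)"
  unfolding locally_integrable_def set_integrable_def
proof safe
  fix K :: "(real^'a) set" assume "compact K"
  then obtain R where R: "\<And>x. x \<in> K \<Longrightarrow> norm x \<le> R"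
    using compact_imp_bounded bounded_iff by metis
  have K: "K \<in> sets borel" using \<open>compact K\<close> by (intro borel_closed compact_imp_closed)
  have "integrable lborel (\<lambda>x. v x * (indicator K x * \<psi> x))"
  proof (rule integrable_locally_integrable_mult[OF v, of _ B R])
    show "(\<lambda>x. indicator K x * \<psi> x) \<in> borel_measurable borel"
      using K \<psi> by measurable
    have "0 \<le> B" using B[of undefined] by linarith
    then show "\<bar>indicator K x * \<psi> x\<bar> \<le> B" for x
      using B[of x] by (auto simp: indicator_def)
    show "indicator K x * \<psi> x = 0" if "R < norm x" for x
      using R[of x] that by (auto simp: indicator_def)
  qed
  then show "integrable lborel (\<lambda>x. indicator K x *\<^sub>R (v x * \<psi> x))"
    by (simp add: mult.left_commute)
qed

lemma locally_integrable_continuous: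
  assumes "continuous_on UNIV u"
  shows "locally_integrable u"
  unfolding locally_integrable_def set_integrable_def
  using borel_integrable_compact assms continuous_on_subset by blast

lemma integral_translate:
  fixes f :: "'a::euclidean_space \<Rightarrow> real"
  assumes "f \<in> borel_measurable borel"
  shows "(LINT x|lborel. f (x + a)) = (LINT x|lborel. f x)"
proof -
  have "(LINT x|lborel. f x) = (LINT x|distr lborel borel ((+) a). f x)"
    by (simp add: lborel_distr_plus)
  also have "\<dots> = (LINT x|lborel. f (a + x))"
    by (rule integral_distr) (use assms in auto)
  finally show ?thesis by (simp add: add.commute)
qed

lemma integrable_translate:
  fixes f :: "'a::euclidean_space \<Rightarrow> real"
  assumes "integrable lborel f"
  shows "integrable lborel (\<lambda>x. f (x + a))"
proof -
  have "integrable (distr lborel borel ((+) a)) f"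
    using assms by (simp add: lborel_distr_plus)
  then have "integrable lborel (\<lambda>x. f (a + x))"
    by (rule integrable_distr[rotated]) simp
  then show ?thesis by (simp add: add.commute)
qed

text \<open>The set of agreement is closed and of full measure, hence everything.\<close>

lemma AE_lborel_eq_imp_eq:
  fixes f g :: "'a::euclidean_space \<Rightarrow> real"
  assumes "AE x in lborel. f x = g x" "continuous_on UNIV f" "continuous_on UNIV g"
  shows "f x = g x"
proof -
  have "closed {x. f x = g x}"
    using assms(2,3) by (rule closed_Collect_eq)
  moreover have "AE x in lebesgue. x \<in> {x. f x = g x}"
    using assms(1) by (auto intro: AE_completion)
  ultimately have "x \<in> {x. f x = g x}"
    by (rule mem_closed_if_AE_lebesgue)
  then show ?thesis by simp
qed

text \<open>The fundamental lemma of the calculus of variations. Bumps converge to indicators of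
  boxes, so v has zero integral over every box; its positive and negative parts are then densities
  of measures that agree on an intersection-stable generator of the Borel sets.\<close>

lemma locally_integrable_eq_0:
  fixes v :: "real^'a \<Rightarrow> real"
  assumes v: "locally_integrable v"
    and 0: "\<And>\<phi>. test_function \<phi> \<Longrightarrow> (LINT x|lborel. v x * \<phi> x) = 0"
  shows "AE x in lborel. v x = 0"
proof -
  have [measurable]: "v \<in> borel_measurable borel"
    by (rule locally_integrable_measurable) fact
  have int: "integrable lborel (\<lambda>x. v x * indicator (box a b) x)" for a b
  proof -
    obtain R where "\<And>x. x \<in> box a b \<Longrightarrow> norm x \<le> R"
      using bounded_box bounded_iff by metis
    then show ?thesis
      by (intro integrable_locally_integrable_mult[OF v, of _ 1 R]) (force simp: indicator_def)+
  qed
  have box: "(LINT x|lborel. v x * indicator (box a b) x) = 0" for a b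
  proof (rule LIMSEQ_unique)
    show "(\<lambda>k. LINT x|lborel. v x * bump a b k x) \<longlonglongrightarrow> (LINT x|lborel. v x * indicator (box a b) x)"
    proof (rule integral_dominated_convergence)
      show "integrable lborel (\<lambda>x. \<bar>v x * indicator (box a b) x\<bar>)"
        using int by (rule integrable_abs)
      show "AE x in lborel. (\<lambda>k. v x * bump a b k x) \<longlonglongrightarrow> v x * indicator (box a b) x"
        by (intro AE_I2 tendsto_intros bump_tendsto)
      have "\<bar>v x\<bar> * \<bar>bump a b k x\<bar> \<le> \<bar>v x\<bar> * indicator (box a b) x" for k x
        using bump_bounds[of a b k x] bump_outside[of x a b k]
        by (intro mult_left_mono) (auto simp: indicator_def)
      then show "AE x in lborel. norm (v x * bump a b k x) \<le> \<bar>v x * indicator (box a b) x\<bar>" for k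
        by (simp add: abs_mult)
      have "bump a b k \<in> borel_measurable borel" for k
        unfolding bump_def flat_def by measurable
      then show "(\<lambda>x. v x * bump a b k x) \<in> borel_measurable lborel" for k
        by simp
    qed simp
    show "(\<lambda>k. LINT x|lborel. v x * bump a b k x) \<longlonglongrightarrow> 0"
      by (simp add: 0 test_function_bump)
  qed
  \<comment> \<open>Since \<open>ennreal\<close> sends negative numbers to 0,
    \<open>ennreal (v x)\<close> and \<open>ennreal (- v x)\<close> are the positive and the
    negative part of v. Finiteness on boxes is what the uniqueness theorem for measures asks of an
    exhausting sequence.\<close>
  have eq: "(\<integral>\<^sup>+x. ennreal (v x) * indicator (box a b) x \<partial>lborel) =
      (\<integral>\<^sup>+x. ennreal (- v x) * indicator (box a b) x \<partial>lborel)"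
    and fin: "(\<integral>\<^sup>+x. ennreal (v x) * indicator (box a b) x \<partial>lborel) \<noteq> \<infinity>" for a b
  proof -
    have *: "(\<integral>\<^sup>+x. ennreal (f x) * indicator (box a b) x \<partial>lborel) =
        ennreal (LINT x|lborel. max 0 (f x * indicator (box a b) x))"
      if "integrable lborel (\<lambda>x. f x * indicator (box a b) x)" for f :: "real^'a \<Rightarrow> real"
    proof -
      have "(\<integral>\<^sup>+x. ennreal (f x) * indicator (box a b) x \<partial>lborel) =
          (\<integral>\<^sup>+x. ennreal (max 0 (f x * indicator (box a b) x)) \<partial>lborel)"
        by (intro nn_integral_cong) (auto simp: indicator_def max_def ennreal_neg)
      also have "\<dots> = ennreal (LINT x|lborel. max 0 (f x * indicator (box a b) x))"
        using that by (intro nn_integral_eq_integral integrable_max) auto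
      finally show ?thesis .
    qed
    have "(LINT x|lborel. max 0 (v x * indicator (box a b) x)) -
        (LINT x|lborel. max 0 (- v x * indicator (box a b) x)) =
        (LINT x|lborel. max 0 (v x * indicator (box a b) x) - max 0 (- v x * indicator (box a b) x))"
      using int[of a b] by (intro Bochner_Integration.integral_diff[symmetric] integrable_max) auto
    also have "\<dots> = (LINT x|lborel. v x * indicator (box a b) x)"
      by (intro Bochner_Integration.integral_cong) auto
    finally show "(\<integral>\<^sup>+x. ennreal (v x) * indicator (box a b) x \<partial>lborel) =
      (\<integral>\<^sup>+x. ennreal (- v x) * indicator (box a b) x \<partial>lborel)"
      using *[OF int] *[of "\<lambda>x. - v x"] int[of a b] box by simp
    show "(\<integral>\<^sup>+x. ennreal (v x) * indicator (box a b) x \<partial>lborel) \<noteq> \<infinity>"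
      using *[OF int] by simp
  qed
  have "density lborel (\<lambda>x. ennreal (v x)) = density lborel (\<lambda>x. ennreal (- v x))"
  proof (rule measure_eqI_generator_eq)
    let ?E = "range (\<lambda>(a, b). box a b::(real^'a) set)"
    show "Int_stable ?E"
      by (auto simp: Int_stable_def box_Int_box)
    show "?E \<subseteq> Pow UNIV" "sets (density lborel (\<lambda>x. ennreal (v x))) = sigma_sets UNIV ?E"
      "sets (density lborel (\<lambda>x. ennreal (- v x))) = sigma_sets UNIV ?E"
      by (simp_all add: borel_eq_box)
    let ?A = "\<lambda>n::nat. box (- (real n *\<^sub>R One)) (real n *\<^sub>R One) :: (real^'a) set"
    show "range ?A \<subseteq> ?E" "(\<Union>i. ?A i) = UNIV"
      unfolding UN_box_eq_UNIV by auto
    show "emeasure (density lborel (\<lambda>x. ennreal (v x))) (?A i) \<noteq> \<infinity>" for i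
      using fin by (simp add: emeasure_density)
    show "emeasure (density lborel (\<lambda>x. ennreal (v x))) X = emeasure (density lborel (\<lambda>x. ennreal (- v x))) X"
      if "X \<in> ?E" for X
      using that eq by (auto simp: emeasure_density)
  qed
  then have "AE x in lborel. ennreal (v x) = ennreal (- v x)"
    by (subst (asm) sigma_finite_measure.density_unique_iff[OF sigma_finite_lborel]) auto
  then show ?thesis
  proof eventually_elim
    case (elim x)
    then show ?case
      by (cases "v x" "0::real" rule: linorder_cases) (auto simp: ennreal_neg ennreal_eq_0_iff)
  qed
qed

section \<open>Test functions and difference quotients\<close>

lemma test_function_differentiable:
  assumes "test_function \<phi>"
  shows "\<phi> differentiable (at x)"
proof -
  have "foldr partial_deriv [] \<phi> differentiable (at x)"
    using assms unfolding test_function_def smooth_fun_def by blast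
  then show ?thesis by simp
qed

lemma test_function_continuous:
  assumes "test_function \<phi>"
  shows "continuous_on A \<phi>"
  by (intro continuous_at_imp_continuous_on ballI differentiable_imp_continuous_within
      test_function_differentiable[OF assms])

lemma test_function_measurable [measurable]:
  "test_function \<phi> \<Longrightarrow> \<phi> \<in> borel_measurable borel"
  by (intro borel_measurable_continuous_onI test_function_continuous)

lemma test_function_partial_deriv:
  assumes "test_function \<phi>"
  shows "test_function (partial_deriv i \<phi>)"
proof -
  have "smooth_fun (partial_deriv i \<phi>)"
    unfolding smooth_fun_def
  proof safe
    fix "is" x
    have "foldr partial_deriv (is @ [i]) \<phi> differentiable at x"
      using assms unfolding test_function_def smooth_fun_def by blast
    then show "foldr partial_deriv is (partial_deriv i \<phi>) differentiable at x"
      by simp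
  qed
  moreover have "{x. partial_deriv i \<phi> x \<noteq> 0} \<subseteq> closure {x. \<phi> x \<noteq> 0}"
  proof (rule ccontr)
    assume "\<not> ?thesis"
    then obtain x where x: "partial_deriv i \<phi> x \<noteq> 0" "x \<in> - closure {x. \<phi> x \<noteq> 0}" by auto
    have "(\<phi> has_derivative (\<lambda>_. 0)) (at x)"
    proof (rule has_derivative_transform_within_open)
      show "((\<lambda>x. 0::real) has_derivative (\<lambda>_. 0)) (at x)" by simp
      show "0 = \<phi> y" if "y \<in> - closure {x. \<phi> x \<noteq> 0}" for y
        using that closure_subset[of "{x. \<phi> x \<noteq> 0}"] by auto
    qed (use x(2) in auto)
    then have "frechet_derivative \<phi> (at x) = (\<lambda>_. 0)"
      by (rule frechet_derivative_at[symmetric])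
    with x(1) show False by (simp add: partial_deriv_def)
  qed
  then have "closure {x. partial_deriv i \<phi> x \<noteq> 0} \<subseteq> closure {x. \<phi> x \<noteq> 0}"
    by (simp add: closure_minimal)
  ultimately show ?thesis
    using assms unfolding test_function_def compact_closure
    by (meson bounded_subset closure_subset order_trans bounded_closure)
qed

lemma test_function_support:
  assumes "test_function \<phi>"
  obtains R where "R > 0" "\<And>x. R < norm x \<Longrightarrow> \<phi> x = 0"
proof -
  have "bounded {x. \<phi> x \<noteq> 0}"
    using assms unfolding test_function_def compact_closure by (rule conjunct2)
  then obtain R where "R > 0" "\<And>x. \<phi> x \<noteq> 0 \<Longrightarrow> norm x \<le> R"
    unfolding bounded_pos by auto
  then show thesis by (intro that[of R]) force+
qed

lemma test_function_bounded:
  assumes "test_function \<phi>"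
  obtains B where "B > 0" "\<And>x. \<bar>\<phi> x\<bar> \<le> B"
proof -
  obtain R where R: "R > 0" "\<And>x. R < norm x \<Longrightarrow> \<phi> x = 0"
    using test_function_support[OF assms] by blast
  have "compact (\<phi> ` cball 0 R)"
    by (intro compact_continuous_image test_function_continuous assms compact_cball)
  then obtain B where B: "B > 0" "\<And>x. x \<in> cball 0 R \<Longrightarrow> \<bar>\<phi> x\<bar> \<le> B"
    unfolding compact_eq_bounded_closed bounded_pos by auto
  have "\<bar>\<phi> x\<bar> \<le> B" for x
    using B R(2)[of x] by (cases "R < norm x") auto
  with B(1) that show thesis by blast
qed

lemma integrable_test_mult:
  assumes "locally_integrable v" "test_function \<phi>"
  shows "integrable lborel (\<lambda>x. v x * \<phi> x)"
proof -
  obtain R where "\<And>x. R < norm x \<Longrightarrow> \<phi> x = 0"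
    using test_function_support[OF assms(2)] by blast
  moreover obtain B where "\<And>x. \<bar>\<phi> x\<bar> \<le> B"
    using test_function_bounded[OF assms(2)] by blast
  ultimately show ?thesis
    using assms by (intro integrable_locally_integrable_mult) auto
qed

lemma has_derivative_translate:
  assumes "(f has_derivative D) (at (x + a))"
  shows "((\<lambda>x. f (x + a)) has_derivative D) (at x)"
  by (rule has_derivative_compose[of "\<lambda>x. x + a" "\<lambda>h. h" x UNIV f D])
     (use assms in \<open>auto intro!: derivative_eq_intros\<close>)

lemma partial_deriv_translate:
  assumes "\<And>x. f differentiable (at x)"
  shows "partial_deriv i (\<lambda>x. f (x + a)) = (\<lambda>x. partial_deriv i f (x + a))"
proof
  fix x
  have "(f has_derivative frechet_derivative f (at (x + a))) (at (x + a))"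
    by (rule frechet_derivative_works[THEN iffD1, OF assms])
  then have "((\<lambda>x. f (x + a)) has_derivative frechet_derivative f (at (x + a))) (at x)"
    by (rule has_derivative_translate)
  from frechet_derivative_at[OF this]
  show "partial_deriv i (\<lambda>x. f (x + a)) x = partial_deriv i f (x + a)"
    unfolding partial_deriv_def by simp
qed

lemma test_function_translate:
  assumes "test_function \<phi>"
  shows "test_function (\<lambda>x. \<phi> (x + a))"
proof -
  have d: "foldr partial_deriv is \<phi> differentiable (at x)" for "is" x
    using assms unfolding test_function_def smooth_fun_def by blast
  have "foldr partial_deriv is (\<lambda>x. \<phi> (x + a)) = (\<lambda>x. foldr partial_deriv is \<phi> (x + a))" for "is"
  proof (induction "is")
    case (Cons j js)
    then show ?case
      using partial_deriv_translate[OF d] by simp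
  qed simp
  moreover have "(\<lambda>x. foldr partial_deriv is \<phi> (x + a)) differentiable (at x)" for "is" x
  proof -
    obtain D where "(foldr partial_deriv is \<phi> has_derivative D) (at (x + a))"
      using d[of "is" "x + a"] unfolding differentiable_def by (rule exE)
    from has_derivative_translate[OF this] show ?thesis
      by (rule differentiableI)
  qed
  ultimately have "smooth_fun (\<lambda>x. \<phi> (x + a))"
    unfolding smooth_fun_def by simp
  moreover have "bounded {x. \<phi> (x + a) \<noteq> 0}"
  proof -
    obtain R where R: "\<And>x. R < norm x \<Longrightarrow> \<phi> x = 0"
      using test_function_support[OF assms] by blast
    have "norm x \<le> R + norm a" if "\<phi> (x + a) \<noteq> 0" for x
    proof -
      have "norm (x + a) \<le> R" using R[of "x + a"] that by linarith
      moreover have "norm x \<le> norm (x + a) + norm a"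
        using norm_triangle_ineq4[of "x + a" a] by simp
      ultimately show ?thesis by simp
    qed
    then show ?thesis unfolding bounded_iff by blast
  qed
  ultimately show ?thesis
    unfolding test_function_def compact_closure by (rule conjI)
qed

lemma test_function_has_partial_deriv:
  assumes "test_function \<phi>"
  shows "((\<lambda>t. \<phi> (x + t *\<^sub>R axis i 1)) has_real_derivative partial_deriv i \<phi> (x + t *\<^sub>R axis i 1)) (at t)"
proof -
  let ?D = "frechet_derivative \<phi> (at (x + t *\<^sub>R axis i 1))"
  have D: "(\<phi> has_derivative ?D) (at (x + t *\<^sub>R axis i 1))"
    by (rule frechet_derivative_works[THEN iffD1, OF test_function_differentiable[OF assms]])
  have "((\<lambda>t. \<phi> (x + t *\<^sub>R axis i 1)) has_derivative (\<lambda>s. ?D (s *\<^sub>R axis i 1))) (at t)"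
    by (rule has_derivative_compose[where f = "\<lambda>t. x + t *\<^sub>R axis i 1" and g = \<phi>, OF _ D])
       (auto intro!: derivative_eq_intros)
  moreover have "?D (s *\<^sub>R axis i 1) = s * ?D (axis i 1)" for s
    using linear_scale[OF linear_frechet_derivative[OF test_function_differentiable[OF assms]]] by simp
  ultimately show ?thesis
    by (simp add: has_field_derivative_def partial_deriv_def mult.commute[of _ "?D (axis i 1)"])
qed

lemma test_function_difference_bound:
  assumes "test_function \<phi>" and B: "\<And>x. \<bar>partial_deriv i \<phi> x\<bar> \<le> B"
  shows "\<bar>\<phi> (x + h *\<^sub>R axis i 1) - \<phi> x\<bar> \<le> B * \<bar>h\<bar>"
proof -
  have "norm (\<phi> (x + h *\<^sub>R axis i 1) - \<phi> (x + 0 *\<^sub>R axis i 1)) \<le> B * norm (h - 0)"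
    by (rule field_differentiable_bound[of UNIV "\<lambda>t. \<phi> (x + t *\<^sub>R axis i 1)" "\<lambda>t. partial_deriv i \<phi> (x + t *\<^sub>R axis i 1)"])
       (use test_function_has_partial_deriv[OF assms(1)] B in auto)
  then show ?thesis by simp
qed

text \<open>Dominated convergence: the mean value bound controls the quotients uniformly, and their
  supports stay in one ball. The limit is two-sided because both forward and backward quotients are
  used later.\<close>

lemma tendsto_integral_difference_quotient:
  assumes f: "locally_integrable f" and g: "test_function g"
  shows "((\<lambda>h. LINT x|lborel. f x * ((g (x + h *\<^sub>R axis i 1) - g x) / h)) \<longlongrightarrow>
     (LINT x|lborel. f x * partial_deriv i g x)) (at 0)"
  unfolding tendsto_at_iff_sequentially comp_def
proof safe
  fix X :: "nat \<Rightarrow> real"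
  assume X: "\<forall>k. X k \<in> UNIV - {0}" and X0: "X \<longlonglongrightarrow> 0"
  obtain B where B: "B > 0" "\<And>x. \<bar>partial_deriv i g x\<bar> \<le> B"
    using test_function_bounded[OF test_function_partial_deriv[OF g]] by blast
  obtain R where R: "R > 0" "\<And>x. R < norm x \<Longrightarrow> g x = 0"
    using test_function_support[OF g] by blast
  \<comment> \<open>A bound on all step lengths: the supports of the shifted functions lie in the
    ball of radius \<open>R + C\<close>.\<close>
  obtain C where C: "\<And>k. \<bar>X k\<bar> \<le> C"
    using Bseq_conv_Bfun[of X] convergent_imp_Bseq[OF convergentI[OF X0]] unfolding Bseq_def by auto
  have [measurable]: "f \<in> borel_measurable borel" "g \<in> borel_measurable borel"
    using locally_integrable_measurable[OF f] g by auto
  show "(\<lambda>k. LINT x|lborel. f x * ((g (x + X k *\<^sub>R axis i 1) - g x) / X k)) \<longlonglongrightarrow>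
     (LINT x|lborel. f x * partial_deriv i g x)"
  proof (rule integral_dominated_convergence)
    show "(\<lambda>x. f x * partial_deriv i g x) \<in> borel_measurable lborel"
      using test_function_measurable[OF test_function_partial_deriv[OF g]] by simp
    have "integrable lborel (\<lambda>x. f x * (B * indicator (cball 0 (R + C)) x))"
      using B by (intro integrable_locally_integrable_mult[OF f, of _ B "R + C"]) (auto simp: indicator_def)
    then show "integrable lborel (\<lambda>x. \<bar>f x * (B * indicator (cball 0 (R + C)) x)\<bar>)"
      by (rule integrable_abs)
    show "AE x in lborel. (\<lambda>k. f x * ((g (x + X k *\<^sub>R axis i 1) - g x) / X k)) \<longlonglongrightarrow> f x * partial_deriv i g x"
    proof (intro AE_I2 tendsto_intros)
      fix x
      have "((\<lambda>h. (g (x + h *\<^sub>R axis i 1) - g x) / h) \<longlongrightarrow> partial_deriv i g x) (at 0)"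
        using test_function_has_partial_deriv[OF g, of x i 0] by (simp add: DERIV_def)
      then show "(\<lambda>k. (g (x + X k *\<^sub>R axis i 1) - g x) / X k) \<longlonglongrightarrow> partial_deriv i g x"
        using X X0 unfolding tendsto_at_iff_sequentially comp_def by blast
    qed
    show "AE x in lborel. norm (f x * ((g (x + X k *\<^sub>R axis i 1) - g x) / X k))
         \<le> \<bar>f x * (B * indicator (cball 0 (R + C)) x)\<bar>" for k
    proof (intro AE_I2)
      fix x :: "real^'a"
      have "\<bar>(g (x + X k *\<^sub>R axis i 1) - g x) / X k\<bar> \<le> B * indicator (cball 0 (R + C)) x"
      proof (cases "norm x \<le> R + C")
        case True
        then show ?thesis
          using test_function_difference_bound[OF g B(2), of x "X k"] X
          by (simp add: divide_le_eq)
      next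
        case False
        have "norm x \<le> norm (x + X k *\<^sub>R axis i 1) + \<bar>X k\<bar>"
          using norm_triangle_ineq4[of "x + X k *\<^sub>R axis i 1" "X k *\<^sub>R axis i 1"] by simp
        then have "R < norm (x + X k *\<^sub>R axis i 1)" "R < norm x"
          using False C[of k] by auto
        then show ?thesis using False R(2) by simp
      qed
      then show "norm (f x * ((g (x + X k *\<^sub>R axis i 1) - g x) / X k))
         \<le> \<bar>f x * (B * indicator (cball 0 (R + C)) x)\<bar>"
        using B(1) by (simp only: abs_mult real_norm_def) (intro mult_left_mono; simp)
    qed
  qed auto
qed

section \<open>Increments of weakly differentiable functions\<close>

lemma locally_integrable_diff:
  assumes "locally_integrable f" "locally_integrable g"
  shows "locally_integrable (\<lambda>x. f x - g x)"
  using assms unfolding locally_integrable_def by (auto intro: set_integral_diff)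

lemma locally_integrable_cmult:
  assumes "locally_integrable f"
  shows "locally_integrable (\<lambda>x. c * f x)"
  using assms unfolding locally_integrable_def by auto

text \<open>By translation invariance every slice in t has the same L^1 norm, and restricting t to
  the unit interval makes the double integral finite.\<close>

lemma integrable_pair_shift:
  fixes g :: "real^'n \<Rightarrow> real"
  assumes g: "integrable lborel g"
  shows "integrable (lborel \<Otimes>\<^sub>M lborel) (\<lambda>(t::real, x). indicator {0..1} t * g (x + t *\<^sub>R d))"
proof (rule lborel_pair.Fubini_integrable)
  have [measurable]: "g \<in> borel_measurable borel"
    using borel_measurable_integrable[OF g] by simp
  show "(\<lambda>(t::real, x). indicator {0..1} t * g (x + t *\<^sub>R d)) \<in> borel_measurable (lborel \<Otimes>\<^sub>M lborel)"
    by measurable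
  have "(LINT x|lborel. norm (case (t, x) of (t, x) \<Rightarrow> indicator {0..1} t * g (x + t *\<^sub>R d))) =
      indicator {0..1} t * (LINT x|lborel. \<bar>g x\<bar>)" for t :: real
    using integral_translate[of "\<lambda>x. \<bar>g x\<bar>" "t *\<^sub>R d"] by (simp add: abs_mult)
  then show "integrable lborel (\<lambda>t::real. LINT x|lborel. norm (case (t, x) of (t, x) \<Rightarrow> indicator {0..1} t * g (x + t *\<^sub>R d)))"
    by simp
  show "AE t in lborel. integrable lborel (\<lambda>x. case (t::real, x) of (t, x) \<Rightarrow> indicator {0..1} t * g (x + t *\<^sub>R d))"
    using integrable_translate[OF g] by simp
qed

text \<open>This licenses every use of Fubini below. The factor \<open>\<psi>\<close> confines x to
  a ball, and then \<open>x + t *\<^sub>R d\<close> with t in [0,1] stays within radius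
  \<open>R + norm d\<close>; there v may be replaced by an integrable truncation.\<close>

lemma integrable_pair_shift_mult:
  fixes v :: "real^'n \<Rightarrow> real"
  assumes v: "locally_integrable v" and \<psi>[measurable]: "\<psi> \<in> borel_measurable borel"
    and B: "\<And>x. \<bar>\<psi> x\<bar> \<le> B" and R: "\<And>x. R < norm x \<Longrightarrow> \<psi> x = 0"
  shows "integrable (lborel \<Otimes>\<^sub>M lborel) (\<lambda>(t::real, x). indicator {0..1} t * (v (x + t *\<^sub>R d) * \<psi> x))"
proof (rule Bochner_Integration.integrable_bound)
  have [measurable]: "v \<in> borel_measurable borel"
    by (rule locally_integrable_measurable[OF v])
  have B0: "0 \<le> B" using B[of 0] by linarith
  define g where "g = (\<lambda>x. v x * (B * indicator (cball 0 (R + norm d)) x))"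
  have "integrable lborel g"
    unfolding g_def by (rule integrable_locally_integrable_mult[OF v, of _ B "R + norm d"])
      (use B0 in \<open>auto simp: indicator_def\<close>)
  then show "integrable (lborel \<Otimes>\<^sub>M lborel) (\<lambda>(t::real, x). indicator {0..1} t * g (x + t *\<^sub>R d))"
    by (rule integrable_pair_shift)
  show "(\<lambda>(t::real, x). indicator {0..1} t * (v (x + t *\<^sub>R d) * \<psi> x)) \<in> borel_measurable (lborel \<Otimes>\<^sub>M lborel)"
    by measurable
  have "norm (indicator {0..1} t * (v (x + t *\<^sub>R d) * \<psi> x)) \<le> norm (indicator {0..1} t * g (x + t *\<^sub>R d))"
    for t :: real and x
  proof (cases "t \<in> {0..1} \<and> norm x \<le> R")
    case True
    have "norm (x + t *\<^sub>R d) \<le> norm x + \<bar>t\<bar> * norm d"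
      using norm_triangle_ineq[of x "t *\<^sub>R d"] by simp
    also have "\<dots> \<le> R + norm d"
      using True mult_right_mono[of "\<bar>t\<bar>" 1 "norm d"] by auto
    finally show ?thesis
      using True B[of x] B0 mult_left_mono[OF B[of x], of "\<bar>v (x + t *\<^sub>R d)\<bar>"]
      by (simp add: g_def abs_mult)
  qed (use R in \<open>auto simp: not_le\<close>)
  then show "AE y in lborel \<Otimes>\<^sub>M lborel. norm (case y of (t::real, x) \<Rightarrow> indicator {0..1} t * (v (x + t *\<^sub>R d) * \<psi> x))
      \<le> norm (case y of (t, x) \<Rightarrow> indicator {0..1} t * g (x + t *\<^sub>R d))"
    by (auto split: prod.splits)
qed

text \<open>Paired with a test function, the left side has a derivative in \<open>a\<close> given by the weak formulation;
  integrating it back and applying Fubini gives the right side.\<close>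

lemma weak_partial_increment:
  fixes u :: "real^'n \<Rightarrow> real"
  assumes u: "continuous_on UNIV u" and v: "is_weak_partial u i v"
  shows "AE x in lborel. u (x + a *\<^sub>R axis i 1) - u x =
    a * (LINT t|lborel. indicator {0..1} t * v (x + t *\<^sub>R (a *\<^sub>R axis i 1)))"
proof -
  define e :: "real^'n" where "e = axis i 1"
  define G where "G x = (LINT t|lborel. indicator {0..1} t * v (x + t *\<^sub>R (a *\<^sub>R e)))" for x
  have v': "locally_integrable v" using v by (simp add: is_weak_partial_def)
  have u': "locally_integrable u" by (rule locally_integrable_continuous[OF u])
  have [measurable]: "v \<in> borel_measurable borel" "u \<in> borel_measurable borel"
    using locally_integrable_measurable v' u' by blast+
  have G: "locally_integrable G"
    unfolding locally_integrable_def set_integrable_def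
  proof safe
    fix K :: "(real^'n) set" assume "compact K"
    then obtain R where R: "\<And>x. x \<in> K \<Longrightarrow> norm x \<le> R"
      using compact_imp_bounded bounded_iff by metis
    have K[measurable]: "K \<in> sets borel"
      using \<open>compact K\<close> by (intro borel_closed compact_imp_closed)
    \<comment> \<open>Local integrability of \<open>G\<close> comes from Fubini with the indicator
      of K as the bounded factor.\<close>
    have "integrable (lborel \<Otimes>\<^sub>M lborel) (\<lambda>(t::real, x). indicator {0..1} t * (v (x + t *\<^sub>R (a *\<^sub>R e)) * indicator K x))"
      by (rule integrable_pair_shift_mult[OF v', of _ 1 R]) (use R in \<open>force simp: indicator_def\<close>)+
    from lborel_pair.integrable_snd[OF this]
    have "integrable lborel (\<lambda>x. (LINT t::real|lborel. (indicator {0..1} t * v (x + t *\<^sub>R (a *\<^sub>R e))) * indicator K x))"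
      by (simp add: mult.assoc)
    then have "integrable lborel (\<lambda>x. G x * indicator K x)"
      unfolding G_def by (subst (asm) integral_mult_left_zero)
    then show "integrable lborel (\<lambda>x. indicator K x *\<^sub>R G x)"
      by (simp add: mult.commute)
  qed
  have ut: "locally_integrable (\<lambda>x. u (x + a *\<^sub>R e))"
    by (rule locally_integrable_continuous) (intro continuous_intros continuous_on_compose2[OF u]; simp)
  have "AE x in lborel. u (x + a *\<^sub>R e) - u x - a * G x = 0"
  proof (rule locally_integrable_eq_0)
    show "locally_integrable (\<lambda>x. u (x + a *\<^sub>R e) - u x - a * G x)"
      by (intro locally_integrable_diff locally_integrable_cmult ut u' G)
    fix \<phi> :: "real^'n \<Rightarrow> real" assume \<phi>: "test_function \<phi>"
    have [measurable]: "\<phi> \<in> borel_measurable borel" using \<phi> by measurable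
    \<comment> \<open>The shift is put on the test function, where differentiation in r is
      legitimate: u itself has no pointwise derivative to work with.\<close>
    define M where "M r = (LINT x|lborel. u x * \<phi> (x + r *\<^sub>R e))" for r
    define J where "J r = (LINT x|lborel. v x * \<phi> (x + r *\<^sub>R e))" for r
    have M: "(M has_real_derivative - J r) (at r)" for r
    proof -
      define g where "g = (\<lambda>x. \<phi> (x + r *\<^sub>R e))"
      have g: "test_function g" unfolding g_def by (rule test_function_translate[OF \<phi>])
      have gt: "test_function (\<lambda>x. g (x + h *\<^sub>R e))" for h by (rule test_function_translate[OF g])
      have "((\<lambda>h. LINT x|lborel. u x * ((g (x + h *\<^sub>R e) - g x) / h)) \<longlongrightarrow>
         (LINT x|lborel. u x * partial_deriv i g x)) (at 0)"
        unfolding e_def by (rule tendsto_integral_difference_quotient[OF u' g])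
      moreover have "(LINT x|lborel. u x * ((g (x + h *\<^sub>R e) - g x) / h)) = (M (r + h) - M r) / h" for h
      proof -
        have "(LINT x|lborel. u x * ((g (x + h *\<^sub>R e) - g x) / h)) =
            (LINT x|lborel. (u x * g (x + h *\<^sub>R e) - u x * g x) / h)"
          by (simp add: algebra_simps)
        also have "\<dots> = ((LINT x|lborel. u x * g (x + h *\<^sub>R e)) - (LINT x|lborel. u x * g x)) / h"
          using integrable_test_mult[OF u' g] integrable_test_mult[OF u' gt] by simp
        finally show ?thesis
          by (simp add: M_def g_def algebra_simps)
      qed
      moreover have "(LINT x|lborel. u x * partial_deriv i g x) = - J r"
        using v g by (simp add: is_weak_partial_def J_def g_def)
      ultimately show ?thesis by (simp only: DERIV_def)
    qed
    \<comment> \<open>Translation invariance returns the shift to v.\<close>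
    have J: "J (- (s * a)) = (LINT x|lborel. v (x + s *\<^sub>R (a *\<^sub>R e)) * \<phi> x)" for s
      unfolding J_def
      using integral_translate[of "\<lambda>x. v x * \<phi> (x + (- (s * a)) *\<^sub>R e)" "(s * a) *\<^sub>R e"]
      by simp
    \<comment> \<open>The path is parametrized by s in [0,1] instead of by the length a, so that
      positive and negative a are treated alike.\<close>
    have "((\<lambda>s. a * J (- (s * a))) has_integral M (- (1 * a)) - M (- (0 * a))) {0..1}"
    proof (rule fundamental_theorem_of_calculus)
      fix s :: real
      have "((\<lambda>s. M (- (s * a))) has_real_derivative - J (- (s * a)) * - a) (at s)"
        by (rule DERIV_chain'[where f = "\<lambda>s. - (s * a)", OF _ M]) (auto intro!: derivative_eq_intros)
      then show "((\<lambda>s. M (- (s * a))) has_vector_derivative a * J (- (s * a))) (at s within {0..1})"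
        by (simp add: has_real_derivative_iff_has_vector_derivative has_vector_derivative_at_within mult.commute)
    qed simp
    moreover have "M (- (1 * a)) = (LINT x|lborel. u (x + a *\<^sub>R e) * \<phi> x)"
      using integral_translate[of "\<lambda>x. u x * \<phi> (x + (- a) *\<^sub>R e)" "a *\<^sub>R e"] by (simp add: M_def)
    ultimately have 1: "((\<lambda>s. a * J (- (s * a))) has_integral
        (LINT x|lborel. u (x + a *\<^sub>R e) * \<phi> x) - (LINT x|lborel. u x * \<phi> x)) {0..1}"
      by (simp add: M_def)
    obtain B where B: "\<And>x. \<bar>\<phi> x\<bar> \<le> B"
      using test_function_bounded[OF \<phi>] by blast
    obtain R where R: "\<And>x. R < norm x \<Longrightarrow> \<phi> x = 0"
      using test_function_support[OF \<phi>] by blast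
    have int: "integrable (lborel \<Otimes>\<^sub>M lborel) (\<lambda>(t::real, x). indicator {0..1} t * (v (x + t *\<^sub>R (a *\<^sub>R e)) * \<phi> x))"
      by (rule integrable_pair_shift_mult[OF v' _ B R]) auto
    have "integrable lborel (\<lambda>t::real. indicator {0..1} t * J (- (t * a)))"
      using lborel_pair.integrable_fst[OF int] by (simp add: J)
    from has_integral_integral_lborel[OF this]
    have "((\<lambda>t. J (- (t * a))) has_integral (LINT t|lborel. indicator {0..1} t * J (- (t * a)))) {0..1}"
      by (subst has_integral_restrict_UNIV[symmetric]) (erule has_integral_eq[rotated], simp)
    from has_integral_mult_right[OF this, of a]
    have "((\<lambda>t. a * J (- (t * a))) has_integral a * (LINT t|lborel. indicator {0..1} t * J (- (t * a)))) {0..1}" .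
    with 1 have "(LINT x|lborel. u (x + a *\<^sub>R e) * \<phi> x) - (LINT x|lborel. u x * \<phi> x) =
        a * (LINT t|lborel. indicator {0..1} t * J (- (t * a)))"
      by (rule has_integral_unique)
    also have "(LINT t|lborel. indicator {0..1} t * J (- (t * a))) =
        (LINT t::real|lborel. LINT x|lborel. indicator {0..1} t * (v (x + t *\<^sub>R (a *\<^sub>R e)) * \<phi> x))"
      by (simp add: J)
    also have "\<dots> = (LINT x|lborel. LINT t::real|lborel. indicator {0..1} t * (v (x + t *\<^sub>R (a *\<^sub>R e)) * \<phi> x))"
      using lborel_pair.Fubini_integral[OF int] by simp
    also have "\<dots> = (LINT x|lborel. G x * \<phi> x)"
      by (simp add: G_def flip: mult.assoc)
    finally have *: "(LINT x|lborel. u (x + a *\<^sub>R e) * \<phi> x) - (LINT x|lborel. u x * \<phi> x) = a * (LINT x|lborel. G x * \<phi> x)" .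
    have "(LINT x|lborel. (u (x + a *\<^sub>R e) - u x - a * G x) * \<phi> x) =
        (LINT x|lborel. u (x + a *\<^sub>R e) * \<phi> x - u x * \<phi> x - a * (G x * \<phi> x))"
      by (simp add: algebra_simps)
    also have "\<dots> = (LINT x|lborel. u (x + a *\<^sub>R e) * \<phi> x) - (LINT x|lborel. u x * \<phi> x) - a * (LINT x|lborel. G x * \<phi> x)"
      using integrable_test_mult[OF ut \<phi>] integrable_test_mult[OF u' \<phi>] integrable_test_mult[OF G \<phi>]
      by simp
    finally show "(LINT x|lborel. (u (x + a *\<^sub>R e) - u x - a * G x) * \<phi> x) = 0"
      using * by simp
  qed
  then show ?thesis
    by eventually_elim (simp add: G_def e_def)
qed

section \<open>Chain rule and truncation\<close>

text \<open>Write the increment of T(u) as a divided difference times the increment of u, and insert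
  the increment formula for u. By the mean value theorem the divided difference is a value of
  \<open>T'\<close>, so it is bounded by 1 and tends to \<open>T' (u x)\<close>. Moving the
  translation from v to the remaining factor puts the limit within reach of dominated
  convergence.\<close>

lemma weak_partial_chain:
  fixes u :: "real^'n \<Rightarrow> real"
  assumes u: "continuous_on UNIV u" and v: "is_weak_partial u i v"
    and T: "\<And>s. (T has_real_derivative T' s) (at s)" and T': "continuous_on UNIV T'"
    and T'1: "\<And>s. \<bar>T' s\<bar> \<le> 1"
  shows "is_weak_partial (\<lambda>x. T (u x)) i (\<lambda>x. v x * T' (u x))"
proof -
  define e :: "real^'n" where "e = axis i 1"
  \<comment> \<open>The divided difference of T; the value on the diagonal lets the mean value and
    limit statements hold without excluding equal arguments.\<close>
  define Q where "Q a b = (if a = b then T' a else (T b - T a) / (b - a))" for a b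
  have T_cont: "continuous_on UNIV T"
    using T by (intro continuous_at_imp_continuous_on) (auto intro: DERIV_isCont)
  have v': "locally_integrable v" using v by (simp add: is_weak_partial_def)
  have Tu: "continuous_on UNIV (\<lambda>x. T (u x))"
    by (rule continuous_on_compose2[OF T_cont u]) simp
  have Tu': "locally_integrable (\<lambda>x. T (u x))" by (rule locally_integrable_continuous[OF Tu])
  have [measurable]: "v \<in> borel_measurable borel" "u \<in> borel_measurable borel"
    "T \<in> borel_measurable borel" "T' \<in> borel_measurable borel"
    using locally_integrable_measurable[OF v'] u T_cont T'
    by (auto intro: borel_measurable_continuous_onI)
  have Q_mvt: "\<exists>\<xi>. \<bar>\<xi> - a\<bar> \<le> \<bar>b - a\<bar> \<and> Q a b = T' \<xi>" for a b
  proof (cases a b rule: linorder_cases)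
    case less
    then obtain z where "a < z" "z < b" "T b - T a = (b - a) * T' z"
      using MVT2[of a b T T'] T by blast
    then show ?thesis using less by (intro exI[of _ z]) (auto simp: Q_def)
  next
    case greater
    then obtain z where "b < z" "z < a" "T a - T b = (a - b) * T' z"
      using MVT2[of b a T T'] T by blast
    then show ?thesis using greater by (intro exI[of _ z]) (auto simp: Q_def field_simps)
  qed (auto simp: Q_def)
  have Q_bound: "\<bar>Q a b\<bar> \<le> 1" for a b
    using Q_mvt[of a b] T'1 by auto
  have Q_eq: "T b - T a = Q a b * (b - a)" for a b
    by (simp add: Q_def)
  have Q_lim: "(\<lambda>k. Q (y k) (z k)) \<longlonglongrightarrow> T' l" if y: "y \<longlonglongrightarrow> l" and z: "z \<longlonglongrightarrow> l" for y z l
  proof -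
    have "\<forall>k. \<exists>x. \<bar>x - y k\<bar> \<le> \<bar>z k - y k\<bar> \<and> Q (y k) (z k) = T' x"
      using Q_mvt by blast
    from choice[OF this] obtain \<xi> where
      \<xi>: "\<And>k. \<bar>\<xi> k - y k\<bar> \<le> \<bar>z k - y k\<bar>" "\<And>k. Q (y k) (z k) = T' (\<xi> k)"
      by blast
    have "(\<lambda>k. z k - y k) \<longlonglongrightarrow> l - l" by (intro tendsto_intros y z)
    then have "(\<lambda>k. \<xi> k - y k) \<longlonglongrightarrow> 0"
      by (intro Lim_null_comparison[of "\<lambda>k. \<xi> k - y k" "\<lambda>k. \<bar>z k - y k\<bar>"])
         (use \<xi>(1) in \<open>auto intro: tendsto_rabs_zero\<close>)
    from tendsto_add[OF this y] have "\<xi> \<longlonglongrightarrow> l" by simp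
    then have "(\<lambda>k. T' (\<xi> k)) \<longlonglongrightarrow> T' l"
      by (rule isCont_tendsto_compose[rotated]) (use T' in \<open>simp add: continuous_on_eq_continuous_at\<close>)
    then show ?thesis by (simp add: \<xi>(2))
  qed
  have "(LINT x|lborel. T (u x) * partial_deriv i \<phi> x) = - (LINT x|lborel. v x * T' (u x) * \<phi> x)"
    if \<phi>: "test_function \<phi>" for \<phi>
  proof -
    have [measurable]: "\<phi> \<in> borel_measurable borel" using \<phi> by measurable
    obtain B where B: "B > 0" "\<And>x. \<bar>\<phi> x\<bar> \<le> B"
      using test_function_bounded[OF \<phi>] by blast
    obtain R where R: "\<And>x. R < norm x \<Longrightarrow> \<phi> x = 0"
      using test_function_support[OF \<phi>] by blast
    define h where "h k = inverse (real (Suc k))" for k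
    have h: "h k > 0" "h k \<le> 1" for k
      by (auto simp: h_def field_simps)
    have h0: "h \<longlonglongrightarrow> 0" unfolding h_def by (rule LIMSEQ_inverse_real_of_nat)
    define \<psi> where "\<psi> k x = Q (u x) (u (x + h k *\<^sub>R e)) * \<phi> x" for k x
    have [measurable]: "\<psi> k \<in> borel_measurable borel" for k
      unfolding \<psi>_def Q_def by measurable
    have \<psi>B: "\<bar>\<psi> k x\<bar> \<le> B" for k x
      using mult_mono[OF Q_bound[of "u x" "u (x + h k *\<^sub>R e)"] B(2)[of x]] by (simp add: \<psi>_def abs_mult)
    have \<psi>R: "\<psi> k x = 0" if "R < norm x" for k x
      using R[OF that] by (simp add: \<psi>_def)
    define D where "D k t = (LINT x|lborel. v x * \<psi> k (x - (t * h k) *\<^sub>R e))" for k t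
    \<comment> \<open>One integrable bound for all k and all t in [0,1]: the radius grows by 1
      because \<open>t * h k\<close> is at most 1.\<close>
    define g where "g = (\<lambda>x. \<bar>v x * (B * indicator (cball 0 (R + 1)) x)\<bar>)"
    have g: "integrable lborel g"
      unfolding g_def by (intro integrable_abs integrable_locally_integrable_mult[OF v', of _ B "R + 1"])
        (use B(1) in \<open>auto simp: indicator_def\<close>)
    have dom: "\<bar>v x * \<psi> k (x - (t * h k) *\<^sub>R e)\<bar> \<le> g x" if t: "t \<in> {0..1}" for k t x
    proof (cases "norm x \<le> R + 1")
      case True
      then show ?thesis
        using B(1) mult_left_mono[OF \<psi>B[of k "x - (t * h k) *\<^sub>R e"], of "\<bar>v x\<bar>"]
        by (simp add: g_def abs_mult)
    next
      case False
      have "norm ((t * h k) *\<^sub>R e) \<le> 1"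
        using t h[of k] mult_mono[of t 1 "h k" 1] by (auto simp: e_def abs_mult)
      then have "R < norm (x - (t * h k) *\<^sub>R e)"
        using False norm_triangle_ineq2[of x "(t * h k) *\<^sub>R e"] by linarith
      then show ?thesis using \<psi>R by (simp add: g_def)
    qed
    have D_lim: "(\<lambda>k. D k t) \<longlonglongrightarrow> (LINT x|lborel. v x * T' (u x) * \<phi> x)" if t: "t \<in> {0..1}" for t
      unfolding D_def
    proof (rule integral_dominated_convergence[OF _ _ g])
      show "AE x in lborel. (\<lambda>k. v x * \<psi> k (x - (t * h k) *\<^sub>R e)) \<longlonglongrightarrow> v x * T' (u x) * \<phi> x"
      proof (intro AE_I2)
        fix x
        have c: "(\<lambda>k. f (x + (s * h k) *\<^sub>R e)) \<longlonglongrightarrow> f x" if "continuous_on UNIV f" for f :: "real^'n \<Rightarrow> real" and s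
        proof -
          have "(\<lambda>k. x + (s * h k) *\<^sub>R e) \<longlonglongrightarrow> x + (s * 0) *\<^sub>R e"
            by (intro tendsto_intros h0)
          then show ?thesis
            by (intro isCont_tendsto_compose[of x f]) (use that in \<open>simp_all add: continuous_on_eq_continuous_at\<close>)
        qed
        \<comment> \<open>After the shift by \<open>- t * h k\<close> the two arguments of
          \<open>Q\<close> sit at u of x shifted by \<open>- t * h k\<close> and by
          \<open>(1 - t) * h k\<close>; both points tend to x.\<close>
        have "(\<lambda>k. Q (u (x + ((- t) * h k) *\<^sub>R e)) (u (x + ((1 - t) * h k) *\<^sub>R e)) * \<phi> (x + ((- t) * h k) *\<^sub>R e))
          \<longlonglongrightarrow> T' (u x) * \<phi> x"
          by (intro tendsto_mult Q_lim c u test_function_continuous[OF \<phi>])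
        moreover have "\<psi> k (x - (t * h k) *\<^sub>R e) =
            Q (u (x + ((- t) * h k) *\<^sub>R e)) (u (x + ((1 - t) * h k) *\<^sub>R e)) * \<phi> (x + ((- t) * h k) *\<^sub>R e)" for k
          unfolding \<psi>_def by (simp add: algebra_simps)
        ultimately have "(\<lambda>k. \<psi> k (x - (t * h k) *\<^sub>R e)) \<longlonglongrightarrow> T' (u x) * \<phi> x"
          by simp
        then show "(\<lambda>k. v x * \<psi> k (x - (t * h k) *\<^sub>R e)) \<longlonglongrightarrow> v x * T' (u x) * \<phi> x"
          by (auto simp: mult.assoc intro: tendsto_mult_left)
      qed
      show "AE x in lborel. norm (v x * \<psi> k (x - (t * h k) *\<^sub>R e)) \<le> g x" for k
        using dom[OF t] by simp
    qed measurable
    have int: "integrable (lborel \<Otimes>\<^sub>M lborel) (\<lambda>(t::real, x). indicator {0..1} t * (v (x + t *\<^sub>R (h k *\<^sub>R e)) * \<psi> k x))" for k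
      by (rule integrable_pair_shift_mult[OF v' _ \<psi>B \<psi>R]) auto
    have D_eq: "(LINT x|lborel. v (x + t *\<^sub>R (h k *\<^sub>R e)) * \<psi> k x) = D k t" for k t
      using integral_translate[of "\<lambda>x. v x * \<psi> k (x - (t * h k) *\<^sub>R e)" "(t * h k) *\<^sub>R e"]
      by (simp add: D_def)
    have D_int: "integrable lborel (\<lambda>t::real. indicator {0..1} t * D k t)" for k
      using lborel_pair.integrable_fst[OF int[of k]] by (simp add: D_eq[simplified])
    \<comment> \<open>For each t in the unit interval the limit is the same number, so integrating
      over t returns that number. The integral of \<open>g\<close> dominates uniformly.\<close>
    have "(\<lambda>k. LINT t::real|lborel. indicator {0..1} t * D k t) \<longlonglongrightarrow>
       (LINT t::real|lborel. indicator {0..1} t * (LINT x|lborel. v x * T' (u x) * \<phi> x))"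
    proof (rule integral_dominated_convergence)
      show "integrable lborel (\<lambda>t::real. indicator {0..1} t * (LINT x|lborel. g x))"
        by simp
      show "(\<lambda>t::real. indicator {0..1} t * D k t) \<in> borel_measurable lborel" for k
        using D_int by (rule borel_measurable_integrable)
      show "AE t::real in lborel. (\<lambda>k. indicator {0..1} t * D k t) \<longlonglongrightarrow>
          indicator {0..1} t * (LINT x|lborel. v x * T' (u x) * \<phi> x)"
        using D_lim by (intro AE_I2) (auto simp: indicator_def)
      have "\<bar>D k t\<bar> \<le> (LINT x|lborel. g x)" if "t \<in> {0..1}" for k t
        unfolding D_def 
      proof -
        have "integrable lborel (\<lambda>x. v x * \<psi> k (x - (t * h k) *\<^sub>R e))"
          by (rule Bochner_Integration.integrable_bound[OF g]) (use dom[OF that] in \<open>auto simp: g_def\<close>)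
        from Bochner_Integration.integral_norm_bound_integral[OF this g]
        show "\<bar>LINT x|lborel. v x * \<psi> k (x - (t * h k) *\<^sub>R e)\<bar> \<le> (LINT x|lborel. g x)"
          using dom[OF that] by simp
      qed
      then show "AE t::real in lborel. norm (indicator {0..1} t * D k t) \<le> indicator {0..1} t * (LINT x|lborel. g x)" for k
        by (intro AE_I2) (auto simp: indicator_def)
    qed simp
    then have lim1: "(\<lambda>k. - (LINT t::real|lborel. indicator {0..1} t * D k t)) \<longlonglongrightarrow>
        - (LINT x|lborel. v x * T' (u x) * \<phi> x)"
      by (intro tendsto_minus) simp
    \<comment> \<open>The backward quotient of \<open>\<phi>\<close> is taken because discrete
      integration by parts turns it into a forward increment of T(u), to which the increment formula
      applies.\<close>
    have A_eq: "(LINT x|lborel. T (u x) * ((\<phi> (x + (- h k) *\<^sub>R e) - \<phi> x) / (- h k))) =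
       - (LINT t::real|lborel. indicator {0..1} t * D k t)" for k
    proof -
      have t1: "test_function (\<lambda>x. \<phi> (x + (- h k) *\<^sub>R e))" by (rule test_function_translate[OF \<phi>])
      have Tt: "locally_integrable (\<lambda>x. T (u (x + h k *\<^sub>R e)))"
        by (rule locally_integrable_continuous) (intro continuous_intros continuous_on_compose2[OF Tu]; simp)
      have "(LINT x|lborel. T (u x) * ((\<phi> (x + (- h k) *\<^sub>R e) - \<phi> x) / (- h k))) =
          (LINT x|lborel. (T (u x) * \<phi> (x + (- h k) *\<^sub>R e) - T (u x) * \<phi> x) / (- h k))"
        by (simp add: algebra_simps)
      also have "\<dots> = ((LINT x|lborel. T (u x) * \<phi> (x + (- h k) *\<^sub>R e)) - (LINT x|lborel. T (u x) * \<phi> x)) / (- h k)"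
        using integrable_test_mult[OF Tu' \<phi>] integrable_test_mult[OF Tu' t1] by simp
      also have "(LINT x|lborel. T (u x) * \<phi> (x + (- h k) *\<^sub>R e)) = (LINT x|lborel. T (u (x + h k *\<^sub>R e)) * \<phi> x)"
        using integral_translate[of "\<lambda>x. T (u x) * \<phi> (x + (- h k) *\<^sub>R e)" "h k *\<^sub>R e"] by simp
      also have "((LINT x|lborel. T (u (x + h k *\<^sub>R e)) * \<phi> x) - (LINT x|lborel. T (u x) * \<phi> x)) / (- h k) =
          (LINT x|lborel. (T (u (x + h k *\<^sub>R e)) * \<phi> x - T (u x) * \<phi> x) / (- h k))"
        using integrable_test_mult[OF Tu' \<phi>] integrable_test_mult[OF Tt \<phi>] by simp
      \<comment> \<open>The denominator cancels the step length \<open>h k\<close> that the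
        increment formula carries in front of its line integral; the divided difference and
        \<open>\<phi>\<close> combine to \<open>\<psi> k\<close>.\<close>
      also have "\<dots> = (LINT x|lborel. - ((LINT t|lborel. indicator {0..1} t * v (x + t *\<^sub>R (h k *\<^sub>R e))) * \<psi> k x))"
      proof (rule integral_cong_AE)
        show "AE x in lborel. (T (u (x + h k *\<^sub>R e)) * \<phi> x - T (u x) * \<phi> x) / - h k =
            - ((LINT t|lborel. indicator {0..1} t * v (x + t *\<^sub>R (h k *\<^sub>R e))) * \<psi> k x)"
          using weak_partial_increment[OF u v, of "h k"]
        proof eventually_elim
          case (elim x)
          have "T (u (x + h k *\<^sub>R e)) * \<phi> x - T (u x) * \<phi> x = (T (u (x + h k *\<^sub>R e)) - T (u x)) * \<phi> x"
            by (rule left_diff_distrib[symmetric])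
          also have "\<dots> = (u (x + h k *\<^sub>R e) - u x) * \<psi> k x"
            by (simp only: Q_eq \<psi>_def mult_ac)
          finally have "T (u (x + h k *\<^sub>R e)) * \<phi> x - T (u x) * \<phi> x = (u (x + h k *\<^sub>R e) - u x) * \<psi> k x" .
          then show ?case
            using elim h[of k] by (simp add: e_def)
        qed
      qed measurable
      also have "\<dots> = - (LINT x|lborel. LINT t::real|lborel. indicator {0..1} t * (v (x + t *\<^sub>R (h k *\<^sub>R e)) * \<psi> k x))"
        by (simp flip: mult.assoc)
      also have "\<dots> = - (LINT t::real|lborel. LINT x|lborel. indicator {0..1} t * (v (x + t *\<^sub>R (h k *\<^sub>R e)) * \<psi> k x))"
        using lborel_pair.Fubini_integral[OF int[of k]] by simp
      also have "\<dots> = - (LINT t::real|lborel. indicator {0..1} t * D k t)"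
        by (simp add: D_eq[simplified])
      finally show ?thesis .
    qed
    have "(\<lambda>k. LINT x|lborel. T (u x) * ((\<phi> (x + (- h k) *\<^sub>R e) - \<phi> x) / (- h k))) \<longlonglongrightarrow>
        (LINT x|lborel. T (u x) * partial_deriv i \<phi> x)"
      unfolding e_def
    proof (rule filterlim_compose[OF tendsto_integral_difference_quotient[OF Tu' \<phi>]])
      show "filterlim (\<lambda>k. - h k) (at 0) sequentially"
        using tendsto_minus[OF h0] h by (auto simp: filterlim_at less_imp_neq[symmetric])
    qed
    then show ?thesis
      unfolding A_eq using lim1 by (rule LIMSEQ_unique)
  qed
  moreover have "locally_integrable (\<lambda>x. v x * T' (u x))"
    by (rule locally_integrable_mult_bounded[OF v' _ T'1]) measurable
  ultimately show ?thesis
    by (simp add: is_weak_partial_def)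
qed

text \<open>The limit of the smooth truncations assigns the value \<open>1/2\<close> to the characteristic
  function on the level set \<open>u = m\<close>; any value below \<open>1\<close> there serves the comparison of norms.\<close>

lemma weak_partial_max:
  fixes u :: "real^'n \<Rightarrow> real"
  assumes u: "continuous_on UNIV u" and v: "is_weak_partial u i v"
  shows "is_weak_partial (\<lambda>x. max (u x) m) i (\<lambda>x. v x * ((1 + sgn (u x - m)) / 2))"
proof -
  have v': "locally_integrable v" using v by (simp add: is_weak_partial_def)
  have [measurable]: "v \<in> borel_measurable borel" "u \<in> borel_measurable borel"
    using locally_integrable_measurable[OF v'] u by (auto intro: borel_measurable_continuous_onI)
  \<comment> \<open>\<open>r k\<close> smooths the absolute value of \<open>s - m\<close>. Inserting
    it in max(s, m) = m + ((s - m) + |s - m|)/2 gives C^1 truncations \<open>T k\<close> with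
    derivative bounded by 1, as the chain rule requires.\<close>
  define r where "r k s = sqrt ((s - m)\<^sup>2 + (inverse (real (Suc k)))\<^sup>2)" for k s
  define T where "T k s = m + ((s - m) + r k s) / 2" for k s
  define T' where "T' k s = (1 + (s - m) / r k s) / 2" for k s
  have pos: "(s - m)\<^sup>2 + (inverse (real (Suc k)))\<^sup>2 > 0" for k s
    by (intro add_nonneg_pos) (simp_all del: of_nat_Suc)
  have r_pos: "r k s > 0" for k s
    using pos by (simp add: r_def)
  have r_ge: "\<bar>s - m\<bar> \<le> r k s" for k s
    unfolding r_def by (rule real_le_rsqrt) simp
  have r_le: "r k s \<le> \<bar>s - m\<bar> + 1" for k s
  proof -
    have "r k s \<le> \<bar>s - m\<bar> + inverse (real (Suc k))"
      unfolding r_def using sqrt_sum_squares_le_sum_abs[of "s - m" "inverse (real (Suc k))"] by simp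
    also have "inverse (real (Suc k)) \<le> 1" by (simp add: field_simps)
    finally show ?thesis by simp
  qed
  have r_lim: "(\<lambda>k. r k s) \<longlonglongrightarrow> \<bar>s - m\<bar>" for s
  proof -
    have "(\<lambda>k. r k s) \<longlonglongrightarrow> sqrt ((s - m)\<^sup>2 + 0\<^sup>2)"
      unfolding r_def by (intro tendsto_intros LIMSEQ_inverse_real_of_nat)
    then show ?thesis by simp
  qed
  have T_deriv: "(T k has_real_derivative T' k s) (at s)" for k s
    unfolding T_def[abs_def] T'_def r_def using pos[of s k]
    by (auto intro!: derivative_eq_intros simp: field_simps)
  have T'_cont: "continuous_on UNIV (T' k)" for k
    unfolding T'_def[abs_def] r_def using pos[of _ k]
    by (intro continuous_intros) (auto simp: less_imp_neq[symmetric] simp del: of_nat_Suc)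
  have T'_1: "\<bar>T' k s\<bar> \<le> 1" for k s
  proof -
    define y where "y = (s - m) / r k s"
    have "\<bar>y\<bar> \<le> 1"
      using r_ge[of s k] r_pos[of k s] by (simp add: y_def divide_le_eq)
    then have "\<bar>(1 + y) / 2\<bar> \<le> 1" by (simp add: abs_le_iff)
    then show ?thesis by (simp only: T'_def y_def)
  qed
  have T_lim: "(\<lambda>k. T k s) \<longlonglongrightarrow> max s m" for s
  proof -
    have "(\<lambda>k. T k s) \<longlonglongrightarrow> m + ((s - m) + \<bar>s - m\<bar>) / 2"
      unfolding T_def by (intro tendsto_intros r_lim) simp
    moreover have "m + ((s - m) + \<bar>s - m\<bar>) / 2 = max s m" by (simp add: max_def abs_if field_simps)
    ultimately show ?thesis by simp
  qed
  have T'_lim: "(\<lambda>k. T' k s) \<longlonglongrightarrow> (1 + sgn (s - m)) / 2" for s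
  proof (cases "s = m")
    case False
    then have "(\<lambda>k. T' k s) \<longlonglongrightarrow> (1 + (s - m) / \<bar>s - m\<bar>) / 2"
      unfolding T'_def by (intro tendsto_intros r_lim) auto
    then show ?thesis by (simp add: real_sgn_eq)
  qed (simp add: T'_def)
  have weak: "is_weak_partial (\<lambda>x. T k (u x)) i (\<lambda>x. v x * T' k (u x))" for k
    by (rule weak_partial_chain[OF u v T_deriv T'_cont T'_1])
  have "(LINT x|lborel. max (u x) m * partial_deriv i \<phi> x) =
      - (LINT x|lborel. v x * ((1 + sgn (u x - m)) / 2) * \<phi> x)" if \<phi>: "test_function \<phi>" for \<phi>
  proof (rule LIMSEQ_unique)
    have [measurable]: "\<phi> \<in> borel_measurable borel" "partial_deriv i \<phi> \<in> borel_measurable borel"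
      using \<phi> test_function_partial_deriv by (auto intro: test_function_measurable)
    have [measurable]: "T k \<in> borel_measurable borel" "T' k \<in> borel_measurable borel" for k
      by (rule borel_measurable_continuous_onI, intro continuous_at_imp_continuous_on ballI DERIV_isCont[OF T_deriv])
         (rule borel_measurable_continuous_onI[OF T'_cont])
    show "(\<lambda>k. LINT x|lborel. T k (u x) * partial_deriv i \<phi> x) \<longlonglongrightarrow>
        (LINT x|lborel. max (u x) m * partial_deriv i \<phi> x)"
    proof (rule integral_dominated_convergence)
      show "integrable lborel (\<lambda>x. \<bar>(\<bar>m\<bar> + \<bar>u x - m\<bar> + 1) * partial_deriv i \<phi> x\<bar>)"
        by (intro integrable_abs integrable_test_mult test_function_partial_deriv \<phi>
            locally_integrable_continuous continuous_intros u)
      show "AE x in lborel. (\<lambda>k. T k (u x) * partial_deriv i \<phi> x) \<longlonglongrightarrow> max (u x) m * partial_deriv i \<phi> x"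
        by (intro AE_I2 tendsto_intros T_lim)
      \<comment> \<open>The summand 1 absorbs the smoothing parameter
        \<open>inverse (real (Suc k))\<close> for every k at once.\<close>
      have "\<bar>T k s\<bar> \<le> \<bar>m\<bar> + \<bar>s - m\<bar> + 1" for k s
      proof -
        have "0 \<le> (s - m) + r k s" "(s - m) + r k s \<le> 2 * (\<bar>s - m\<bar> + 1)"
          using r_le[of k s] r_ge[of s k] by (simp_all add: abs_le_iff)
        then have "\<bar>((s - m) + r k s) / 2\<bar> \<le> \<bar>s - m\<bar> + 1" by simp
        then show ?thesis
          unfolding T_def using abs_triangle_ineq[of m "((s - m) + r k s) / 2"] by linarith
      qed
      then show "AE x in lborel. norm (T k (u x) * partial_deriv i \<phi> x)
          \<le> \<bar>(\<bar>m\<bar> + \<bar>u x - m\<bar> + 1) * partial_deriv i \<phi> x\<bar>" for k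
        by (intro AE_I2) (auto simp: abs_mult intro!: mult_right_mono)
    qed measurable
    have "(\<lambda>k. LINT x|lborel. v x * T' k (u x) * \<phi> x) \<longlonglongrightarrow>
        (LINT x|lborel. v x * ((1 + sgn (u x - m)) / 2) * \<phi> x)"
    proof (rule integral_dominated_convergence)
      show "integrable lborel (\<lambda>x. \<bar>v x * \<phi> x\<bar>)"
        by (intro integrable_abs integrable_test_mult \<phi> v')
      show "AE x in lborel. (\<lambda>k. v x * T' k (u x) * \<phi> x) \<longlonglongrightarrow> v x * ((1 + sgn (u x - m)) / 2) * \<phi> x"
        by (intro AE_I2 tendsto_mult T'_lim tendsto_const)
      have "\<bar>T' k s\<bar> * (\<bar>a\<bar> * \<bar>b\<bar>) \<le> \<bar>a\<bar> * \<bar>b\<bar>" for k s and a b :: real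
        using mult_right_mono[OF T'_1[of k s], of "\<bar>a\<bar> * \<bar>b\<bar>"] by simp
      then show "AE x in lborel. norm (v x * T' k (u x) * \<phi> x) \<le> \<bar>v x * \<phi> x\<bar>" for k
        by (intro AE_I2) (simp add: abs_mult ac_simps)
    qed measurable
    then show "(\<lambda>k. LINT x|lborel. T k (u x) * partial_deriv i \<phi> x) \<longlonglongrightarrow>
        - (LINT x|lborel. v x * ((1 + sgn (u x - m)) / 2) * \<phi> x)"
      using weak \<phi> by (simp add: is_weak_partial_def tendsto_minus_cancel_left)
  qed
  moreover have "locally_integrable (\<lambda>x. v x * ((1 + sgn (u x - m)) / 2))"
    by (rule locally_integrable_mult_bounded[OF v', of _ 1]) (measurable, auto simp: sgn_real_def)
  ultimately show ?thesis
    by (simp add: is_weak_partial_def)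
qed

section \<open>Gradient norms\<close>

text \<open>The difference of two candidates annihilates all test functions.
  \<open>weak_grad\<close> selects its components by \<open>SOME\<close>, and this is what makes the
  selection harmless.\<close>

lemma weak_partial_unique:
  assumes v: "is_weak_partial u i v" and w: "is_weak_partial u i w"
  shows "AE x in lborel. v x = w x"
proof -
  have "AE x in lborel. v x - w x = 0"
  proof (rule locally_integrable_eq_0)
    show "locally_integrable (\<lambda>x. v x - w x)"
      using v w by (simp add: is_weak_partial_def locally_integrable_diff)
    fix \<phi> :: "real^'a \<Rightarrow> real" assume \<phi>: "test_function \<phi>"
    have "(LINT x|lborel. (v x - w x) * \<phi> x) = (LINT x|lborel. v x * \<phi> x) - (LINT x|lborel. w x * \<phi> x)"
      using v w by (simp add: is_weak_partial_def integrable_test_mult \<phi> left_diff_distrib)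
    then show "(LINT x|lborel. (v x - w x) * \<phi> x) = 0"
      using v w \<phi> by (simp add: is_weak_partial_def)
  qed
  then show ?thesis by simp
qed

lemma weak_partial_cong_AE:
  assumes v: "is_weak_partial u i v" and w: "locally_integrable w" and "AE x in lborel. v x = w x"
  shows "is_weak_partial u i w"
proof -
  have [measurable]: "v \<in> borel_measurable borel" "w \<in> borel_measurable borel"
    using v w by (auto simp: is_weak_partial_def intro: locally_integrable_measurable)
  have "(LINT x|lborel. v x * \<phi> x) = (LINT x|lborel. w x * \<phi> x)" if "test_function \<phi>" for \<phi>
    using that assms(3) by (intro integral_cong_AE) (auto intro!: borel_measurable_times)
  then show ?thesis
    using v w by (simp add: is_weak_partial_def)
qed

lemma weak_partial_minus:
  assumes "is_weak_partial u i v"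
  shows "is_weak_partial (\<lambda>x. - u x) i (\<lambda>x. - v x)"
  using assms locally_integrable_cmult[of v "-1"] by (simp add: is_weak_partial_def)

lemma weak_partial_diff:
  assumes u: "locally_integrable u" "is_weak_partial u i v"
    and w: "locally_integrable w" "is_weak_partial w i z"
  shows "is_weak_partial (\<lambda>x. u x - w x) i (\<lambda>x. v x - z x)"
proof -
  have "(LINT x|lborel. (u x - w x) * partial_deriv i \<phi> x) = - (LINT x|lborel. (v x - z x) * \<phi> x)"
    if \<phi>: "test_function \<phi>" for \<phi>
    using assms \<phi> integrable_test_mult[OF _ \<phi>] integrable_test_mult[OF _ test_function_partial_deriv[OF \<phi>]]
    by (simp add: is_weak_partial_def left_diff_distrib)
  then show ?thesis
    using assms by (simp add: is_weak_partial_def locally_integrable_diff)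
qed

text \<open>The increment formula gives invariance under steps along each axis, first almost
  everywhere and by continuity everywhere; any displacement is a finite sum of such steps.\<close>

lemma weak_partials_0_imp_const:
  fixes u :: "real^'n \<Rightarrow> real"
  assumes u: "continuous_on UNIV u" and v: "\<And>i. is_weak_partial u i (v i)"
    and 0: "\<And>i. AE x in lborel. v i x = 0"
  shows "u x = u y"
proof -
  have "locally_integrable (\<lambda>x::real^'n. 0)"
    by (simp add: locally_integrable_def set_integrable_def)
  then have 1: "is_weak_partial u i (\<lambda>x. 0)" for i
    using weak_partial_cong_AE[OF v _ 0] by blast
  have step: "u (x + a *\<^sub>R axis i 1) = u x" for x a i
  proof (rule AE_lborel_eq_imp_eq[where f = "\<lambda>x. u (x + a *\<^sub>R axis i 1)" and g = u])
    show "AE x in lborel. u (x + a *\<^sub>R axis i 1) = u x"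
      using weak_partial_increment[OF u 1, of a i] by simp
    show "continuous_on UNIV (\<lambda>x. u (x + a *\<^sub>R axis i 1))"
      by (intro continuous_intros continuous_on_compose2[OF u]) auto
  qed (rule u)
  have "u (y + (\<Sum>i\<in>I. c i *\<^sub>R axis i 1)) = u y" if "finite I" for I and c :: "'n \<Rightarrow> real"
    using that
  proof induction
    case (insert i I)
    then show ?case
      using step[of "y + (\<Sum>i\<in>I. c i *\<^sub>R axis i 1)" "c i" i] by (simp add: ac_simps)
  qed simp
  from this[of UNIV "\<lambda>i. (x - y) $ i"] show ?thesis
    using basis_expansion[of "x - y"] by (simp add: scalar_mult_eq_scaleR del: vector_minus_component)
qed

lemma borel_measurable_norm_vec:
  assumes "\<And>i. v i \<in> borel_measurable M"
  shows "(\<lambda>x. norm (\<chi> i. (v i x :: real))) \<in> borel_measurable M"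
  unfolding norm_vec_def L2_set_def using assms by simp

text \<open>Allows the gradient norm to be computed from any convenient weak partial derivatives, in
  particular from those given by the truncation formula.\<close>

lemma grad_norm_eq:
  assumes v: "\<And>i. is_weak_partial u i (v i)"
  shows "grad_norm p u = (LINT x|lborel. norm (\<chi> i. v i x) powr p) powr (1 / p)"
proof -
  define w where "w i = (SOME v. is_weak_partial u i v)" for i
  have w: "is_weak_partial u i (w i)" for i
    unfolding w_def by (rule someI[of "is_weak_partial u i", OF v])
  have meas: "v i \<in> borel_measurable lborel" "w i \<in> borel_measurable lborel" for i
    using locally_integrable_measurable[of "v i"] locally_integrable_measurable[of "w i"] v[of i] w[of i]
    by (auto simp: is_weak_partial_def)
  have "AE x in lborel. \<forall>i\<in>UNIV. w i x = v i x"
    by (intro AE_finite_allI weak_partial_unique[OF w v]) simp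
  then have "AE x in lborel. norm (weak_grad u x) powr p = norm (\<chi> i. v i x) powr p"
    by eventually_elim (simp add: weak_grad_def w_def)
  moreover have "(\<lambda>x. norm (weak_grad u x)) = (\<lambda>x. norm (\<chi> i. w i x))"
    by (simp add: weak_grad_def w_def)
  ultimately have "(LINT x|lborel. norm (weak_grad u x) powr p) = (LINT x|lborel. norm (\<chi> i. v i x) powr p)"
    using borel_measurable_norm_vec[of v, OF meas(1)] borel_measurable_norm_vec[of w, OF meas(2)]
    by (intro integral_cong_AE) (simp_all add: powr_real_measurable)
  then show ?thesis by (simp add: grad_norm_def)
qed

text \<open>The norm is at most the dimension times the largest coordinate, whose power is one term
  of an integrable sum. Integrability matters because the Bochner integral of a non-integrable
  function is 0 by convention, so comparing integrals would say nothing about the gradients.\<close>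

lemma integrable_norm_vec_powr:
  assumes v: "\<And>i. in_Lp p (v i)" and p: "p > 0"
  shows "integrable lborel (\<lambda>x::real^'n. norm (\<chi> i::'m::finite. v i x) powr p)"
proof (rule Bochner_Integration.integrable_bound)
  define N where "N = real CARD('m)"
  show "integrable lborel (\<lambda>x. N powr p * (\<Sum>i\<in>UNIV. \<bar>v i x\<bar> powr p))"
    using v by (simp add: in_Lp_def)
  show "(\<lambda>x. norm (\<chi> i::'m. v i x) powr p) \<in> borel_measurable lborel"
    using v by (intro powr_real_measurable borel_measurable_norm_vec) (auto simp: in_Lp_def)
  have "norm (\<chi> i. v i x) powr p \<le> N powr p * (\<Sum>i\<in>UNIV. \<bar>v i x\<bar> powr p)" for x
  proof -
    define M where "M = Max (range (\<lambda>i. \<bar>v i x\<bar>))"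
    obtain j where j: "M = \<bar>v j x\<bar>"
    proof -
      have "M \<in> range (\<lambda>i. \<bar>v i x\<bar>)" unfolding M_def by (intro Max_in) auto
      then show thesis using that by auto
    qed
    have "norm (\<chi> i. v i x) \<le> (\<Sum>i\<in>UNIV. \<bar>v i x\<bar>)"
      using norm_le_l1_cart[of "\<chi> i. v i x"] by simp
    also have "\<dots> \<le> (\<Sum>i\<in>(UNIV::'m set). M)"
      by (intro sum_mono) (simp add: M_def)
    finally have "norm (\<chi> i. v i x) \<le> N * M" by (simp add: N_def)
    then have "norm (\<chi> i. v i x) powr p \<le> (N * M) powr p"
      using p by (intro powr_mono2) auto
    also have "\<dots> = N powr p * \<bar>v j x\<bar> powr p"
      by (simp add: j powr_mult N_def)
    also have "\<dots> \<le> N powr p * (\<Sum>i\<in>UNIV. \<bar>v i x\<bar> powr p)"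
      by (intro mult_left_mono member_le_sum) auto
    finally show ?thesis .
  qed
  moreover have "0 \<le> (\<Sum>i\<in>UNIV. \<bar>v i x\<bar> powr p)" for x
    by (intro sum_nonneg) simp
  ultimately show "AE x in lborel. norm (norm (\<chi> i. v i x) powr p) \<le> norm (N powr p * (\<Sum>i\<in>UNIV. \<bar>v i x\<bar> powr p))"
    by (simp add: abs_of_nonneg)
qed

section \<open>Continuity, negation and truncation in \<open>D1p\<close>, and rigidity when the
  gradient norm is preserved or zero\<close>

lemma D1p_continuous:
  fixes u :: "real^'n \<Rightarrow> real"
  assumes u: "u \<in> D1p p" and p: "real CARD('n) < p"
  shows "continuous_on UNIV u"
proof (intro continuous_at_imp_continuous_on ballI)
  fix x :: "real^'n"
  define \<alpha> where "\<alpha> = 1 - real CARD('n) / p"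
  have \<alpha>: "\<alpha> > 0" using p by (simp add: \<alpha>_def divide_less_eq)
  obtain L where L: "\<And>x y. \<bar>u x - u y\<bar> \<le> L * norm (x - y) powr \<alpha>"
    using u by (auto simp: D1p_def \<alpha>_def)
  have "((\<lambda>y. norm (y - x)) \<longlongrightarrow> 0) (at x)"
    by (rule tendsto_eq_intros | simp)+
  then have "((\<lambda>y. norm (y - x) powr \<alpha>) \<longlongrightarrow> 0) (at x)"
    by (rule tendsto_zero_powrI[OF _ tendsto_const]) (use \<alpha> in auto)
  from tendsto_mult_right_zero[OF this, of L] have "((\<lambda>y. u y - u x) \<longlongrightarrow> 0) (at x)"
    by (rule Lim_null_comparison[rotated]) (use L in auto)
  then show "isCont u x"
    by (simp add: isCont_def LIM_zero_iff)
qed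

lemma D1p_weak_partials:
  assumes "u \<in> D1p p"
  obtains v where "\<And>i. is_weak_partial u i (v i)" "\<And>i. in_Lp p (v i)"
proof -
  have "\<forall>i. \<exists>v. is_weak_partial u i v \<and> in_Lp p v" using assms by (simp add: D1p_def)
  from choice[OF this] that show thesis by blast
qed

lemma D1p_minus:
  assumes "u \<in> D1p p"
  shows "(\<lambda>x. - u x) \<in> D1p p"
proof -
  obtain v where v: "\<And>i. is_weak_partial u i (v i)" "\<And>i. in_Lp p (v i)"
    using D1p_weak_partials[OF assms] by blast
  have "\<exists>v. is_weak_partial (\<lambda>x. - u x) i v \<and> in_Lp p v" for i
    using weak_partial_minus[OF v(1)[of i]] v(2)[of i]
    by (intro exI[of _ "\<lambda>x. - v i x"]) (simp add: in_Lp_def)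
  moreover have "locally_integrable (\<lambda>x. - u x)"
    using assms locally_integrable_cmult[of u "-1"] by (simp add: D1p_def)
  moreover obtain L where "\<And>x y. \<bar>u x - u y\<bar> \<le> L * norm (x - y) powr (1 - real CARD('a) / p)"
    using assms by (auto simp: D1p_def)
  then have "\<bar>- u x - - u y\<bar> \<le> L * norm (x - y) powr (1 - real CARD('a) / p)" for x y
    by (simp only: minus_diff_minus abs_minus_cancel)
  ultimately show ?thesis by (auto simp: D1p_def)
qed

lemma grad_norm_minus:
  assumes "u \<in> D1p p"
  shows "grad_norm p (\<lambda>x. - u x) = grad_norm p u"
proof -
  obtain v where v: "\<And>i. is_weak_partial u i (v i)"
    using D1p_weak_partials[OF assms] by blast
  have "(\<chi> i. - v i x) = - (\<chi> i. v i x)" for x by (simp add: vec_eq_iff)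
  then show ?thesis
    using grad_norm_eq[OF weak_partial_minus[OF v]] grad_norm_eq[OF v] by simp
qed

lemma in_Lp_mult_bounded:
  assumes v: "in_Lp p v" and \<psi>: "\<psi> \<in> borel_measurable borel" "\<And>x. \<bar>\<psi> x\<bar> \<le> 1" and p: "p > 0"
  shows "in_Lp p (\<lambda>x. v x * \<psi> x)"
  unfolding in_Lp_def
proof
  show m: "(\<lambda>x. v x * \<psi> x) \<in> borel_measurable lborel"
    using v \<psi>(1) by (auto simp: in_Lp_def intro: borel_measurable_times)
  show "integrable lborel (\<lambda>x. \<bar>v x * \<psi> x\<bar> powr p)"
  proof (rule Bochner_Integration.integrable_bound)
    show "integrable lborel (\<lambda>x. \<bar>v x\<bar> powr p)" using v by (simp add: in_Lp_def)
    show "(\<lambda>x. \<bar>v x * \<psi> x\<bar> powr p) \<in> borel_measurable lborel"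
      by (intro powr_real_measurable borel_measurable_abs borel_measurable_const m)
    have "\<bar>v x * \<psi> x\<bar> \<le> \<bar>v x\<bar>" for x
      using mult_left_mono[OF \<psi>(2)[of x], of "\<bar>v x\<bar>"] by (simp add: abs_mult)
    then show "AE x in lborel. norm (\<bar>v x * \<psi> x\<bar> powr p) \<le> norm (\<bar>v x\<bar> powr p)"
      using p by (intro AE_I2) (simp add: powr_mono2)
  qed
qed

lemma D1p_max:
  fixes u :: "real^'n \<Rightarrow> real"
  assumes u: "u \<in> D1p p" and p: "real CARD('n) < p"
  shows "(\<lambda>x. max (u x) m) \<in> D1p p"
proof -
  have c: "continuous_on UNIV u" by (rule D1p_continuous[OF assms])
  have p0: "p > 0" using p by linarith
  obtain v where v: "\<And>i. is_weak_partial u i (v i)" "\<And>i. in_Lp p (v i)"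
    using D1p_weak_partials[OF u] by blast
  have [measurable]: "u \<in> borel_measurable borel"
    using c by (rule borel_measurable_continuous_onI)
  have "in_Lp p (\<lambda>x. v i x * ((1 + sgn (u x - m)) / 2))" for i
    by (rule in_Lp_mult_bounded[OF v(2) _ _ p0]) (measurable, auto simp: sgn_real_def)
  then have "\<exists>z. is_weak_partial (\<lambda>x. max (u x) m) i z \<and> in_Lp p z" for i
    using weak_partial_max[OF c v(1)] by blast
  moreover have "locally_integrable (\<lambda>x. max (u x) m)"
    by (intro locally_integrable_continuous continuous_intros c)
  moreover obtain L where "\<And>x y. \<bar>u x - u y\<bar> \<le> L * norm (x - y) powr (1 - real CARD('n) / p)"
    using u by (auto simp: D1p_def)
  then have "\<bar>max (u x) m - max (u y) m\<bar> \<le> L * norm (x - y) powr (1 - real CARD('n) / p)" for x y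
    by (rule order_trans[rotated]) (simp add: max_def)
  ultimately show ?thesis by (auto simp: D1p_def)
qed

text \<open>On \<open>u \<le> m\<close> the truncation at least halves the gradient, so keeping the whole norm
  forces the gradient to vanish there.\<close>

lemma max_eq_if_grad_norm_le:
  fixes u :: "real^'n \<Rightarrow> real"
  assumes u: "u \<in> D1p p" and p: "real CARD('n) < p"
    and le: "grad_norm p u \<le> grad_norm p (\<lambda>x. max (u x) m)"
  shows "u x - max (u x) m = u y - max (u y) m"
proof -
  have c: "continuous_on UNIV u" by (rule D1p_continuous[OF u p])
  have p0: "p > 0" using p by linarith
  obtain v where v: "\<And>i. is_weak_partial u i (v i)" "\<And>i. in_Lp p (v i)"
    using D1p_weak_partials[OF u] by blast
  have [measurable]: "u \<in> borel_measurable borel"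
    using c by (rule borel_measurable_continuous_onI)
  define \<chi>m where "\<chi>m x = (1 + sgn (u x - m)) / 2" for x
  have \<chi>m: "0 \<le> \<chi>m x" "\<chi>m x \<le> 1" for x by (auto simp: \<chi>m_def sgn_real_def)
  have w: "is_weak_partial (\<lambda>x. max (u x) m) i (\<lambda>x. v i x * \<chi>m x)" for i
    unfolding \<chi>m_def by (rule weak_partial_max[OF c v(1)])
  have w_Lp: "in_Lp p (\<lambda>x. v i x * \<chi>m x)" for i
    by (rule in_Lp_mult_bounded[OF v(2) _ _ p0]) (use \<chi>m in \<open>auto simp: \<chi>m_def[abs_def]\<close>)
  define V where "V x = (\<chi> i. v i x)" for x
  have W: "(\<chi> i. v i x * \<chi>m x) = \<chi>m x *\<^sub>R V x" for x
    by (simp add: V_def vec_eq_iff)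
  have iV: "integrable lborel (\<lambda>x. norm (V x) powr p)"
    unfolding V_def by (rule integrable_norm_vec_powr[OF v(2) p0])
  have iW: "integrable lborel (\<lambda>x. norm (\<chi>m x *\<^sub>R V x) powr p)"
    using integrable_norm_vec_powr[of p "\<lambda>i x. v i x * \<chi>m x", OF w_Lp p0] by (simp only: W)
  have "(LINT x|lborel. norm (V x) powr p) powr (1/p) \<le> (LINT x|lborel. norm (\<chi>m x *\<^sub>R V x) powr p) powr (1/p)"
    using le grad_norm_eq[OF v(1)] grad_norm_eq[where v = "\<lambda>i x. v i x * \<chi>m x", OF w] by (simp only: W V_def)
  then have "(LINT x|lborel. norm (V x) powr p) \<le> (LINT x|lborel. norm (\<chi>m x *\<^sub>R V x) powr p)"
    using powr_less_mono2[of "1/p" "LINT x|lborel. norm (\<chi>m x *\<^sub>R V x) powr p" "LINT x|lborel. norm (V x) powr p"] p0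
    by (force simp: not_le[symmetric])
  moreover have mono: "norm (\<chi>m x *\<^sub>R V x) powr p \<le> norm (V x) powr p" for x
    using \<chi>m[of x] p0 by (intro powr_mono2) (auto intro: mult_left_le_one_le)
  \<comment> \<open>The integrand is nonnegative by \<open>mono\<close>, while the assumed
    comparison of norms makes its integral nonpositive.\<close>
  ultimately have "(LINT x|lborel. norm (V x) powr p - norm (\<chi>m x *\<^sub>R V x) powr p) = 0"
    using iV iW integral_mono[OF iW iV] by simp
  then have "AE x in lborel. norm (V x) powr p - norm (\<chi>m x *\<^sub>R V x) powr p = 0"
    using iV iW mono by (subst (asm) integral_nonneg_eq_0_iff_AE) auto
  then have ae: "AE x in lborel. \<forall>i. v i x - v i x * \<chi>m x = 0"
  proof eventually_elim
    case (elim x)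
    \<comment> \<open>\<open>\<chi>m\<close> takes the values 0, 1/2 and 1; where it is not 1 it
      strictly shrinks every nonzero gradient.\<close>
    have "V x = 0 \<or> \<chi>m x = 1"
    proof (rule ccontr)
      assume "\<not> ?thesis"
      then have "norm (\<chi>m x *\<^sub>R V x) < norm (V x)"
        using \<chi>m[of x] by simp
      then have "norm (\<chi>m x *\<^sub>R V x) powr p < norm (V x) powr p"
        using p0 by (intro powr_less_mono2) auto
      with elim show False by simp
    qed
    then show ?case by (auto simp: V_def vec_eq_iff)
  qed
  show ?thesis
  proof (rule weak_partials_0_imp_const)
    show "continuous_on UNIV (\<lambda>x. u x - max (u x) m)"
      by (intro continuous_intros c)
    show "is_weak_partial (\<lambda>x. u x - max (u x) m) i (\<lambda>x. v i x - v i x * \<chi>m x)" for i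
      by (intro weak_partial_diff v w locally_integrable_continuous continuous_intros c)
    show "AE x in lborel. v i x - v i x * \<chi>m x = 0" for i
      using ae by eventually_elim (erule spec)
  qed
qed

lemma grad_norm_0_imp_const:
  fixes u :: "real^'n \<Rightarrow> real"
  assumes u: "u \<in> D1p p" and p: "real CARD('n) < p" and 0: "grad_norm p u = 0"
  shows "u x = u y"
proof -
  have p0: "p > 0" using p by linarith
  obtain v where v: "\<And>i. is_weak_partial u i (v i)" "\<And>i. in_Lp p (v i)"
    using D1p_weak_partials[OF u] by blast
  have "(LINT x|lborel. norm (\<chi> i. v i x) powr p) = 0"
    using 0 grad_norm_eq[OF v(1)] p0 by simp
  then have "AE x in lborel. norm (\<chi> i. v i x) powr p = 0"
    using integrable_norm_vec_powr[OF v(2) p0] by (subst (asm) integral_nonneg_eq_0_iff_AE) auto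
  then have "AE x in lborel. v i x = 0" for i
    by eventually_elim (simp add: vec_eq_iff)
  then show ?thesis
    using weak_partials_0_imp_const[OF D1p_continuous[OF u p] v(1)] by blast
qed

section \<open>Test functions as members of \<open>D1p\<close>\<close>

text \<open>Discrete integration by parts: by translation invariance, forward quotients of
  \<open>\<phi>\<close> paired with f equal, up to sign, backward quotients of f paired with
  \<open>\<phi>\<close>. Both sides converge by the same limit lemma with the roles
  exchanged.\<close>

lemma test_function_weak_partial:
  fixes f :: "real^'n \<Rightarrow> real"
  assumes f: "test_function f"
  shows "is_weak_partial f i (partial_deriv i f)"
proof -
  define e :: "real^'n" where "e = axis i 1"
  have f': "locally_integrable f"
    by (rule locally_integrable_continuous[OF test_function_continuous[OF f]])
  have "(LINT x|lborel. f x * partial_deriv i \<phi> x) = - (LINT x|lborel. partial_deriv i f x * \<phi> x)"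
    if \<phi>: "test_function \<phi>" for \<phi>
  proof -
    have \<phi>': "locally_integrable \<phi>"
      by (rule locally_integrable_continuous[OF test_function_continuous[OF \<phi>]])
    define h where "h k = inverse (real (Suc k))" for k
    have h0: "h \<longlonglongrightarrow> 0" unfolding h_def by (rule LIMSEQ_inverse_real_of_nat)
    have hpos: "h k > 0" for k by (simp add: h_def del: of_nat_Suc)
    have at0: "filterlim h (at 0) sequentially" "filterlim (\<lambda>k. - h k) (at 0) sequentially"
      using h0 tendsto_minus[OF h0] hpos by (auto simp: filterlim_at less_imp_neq[symmetric])
    have q: "(LINT x|lborel. g x * ((f (x + r *\<^sub>R e) - f x) / r)) =
        ((LINT x|lborel. g x * f (x + r *\<^sub>R e)) - (LINT x|lborel. g x * f x)) / r"
      if "locally_integrable g" "test_function f" for f g :: "real^'n \<Rightarrow> real" and r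
      using integrable_test_mult[OF that] integrable_test_mult[OF that(1) test_function_translate[OF that(2)]]
      by (simp add: right_diff_distrib)
    have sh: "(LINT x|lborel. f x * \<phi> (x + h k *\<^sub>R e)) = (LINT x|lborel. \<phi> x * f (x + (- h k) *\<^sub>R e))" for k
    proof -
      have "(\<lambda>x. \<phi> x * f (x + (- h k) *\<^sub>R e)) \<in> borel_measurable borel"
        using test_function_measurable[OF \<phi>] test_function_measurable[OF test_function_translate[OF f]]
        by (intro borel_measurable_times)
      from integral_translate[OF this, of "h k *\<^sub>R e"] show ?thesis
        by (simp add: mult.commute)
    qed
    have "(LINT x|lborel. f x * ((\<phi> (x + h k *\<^sub>R e) - \<phi> x) / h k)) =
        - (LINT x|lborel. \<phi> x * ((f (x + (- h k) *\<^sub>R e) - f x) / (- h k)))" for k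
      unfolding q[OF f' \<phi>] q[OF \<phi>' f] sh using hpos[of k] by (simp add: mult.commute[of "f _"])
    note eq = this
    have "(\<lambda>k. LINT x|lborel. f x * ((\<phi> (x + h k *\<^sub>R e) - \<phi> x) / h k)) \<longlonglongrightarrow>
        (LINT x|lborel. f x * partial_deriv i \<phi> x)"
      unfolding e_def
      by (rule filterlim_compose[OF tendsto_integral_difference_quotient[OF f' \<phi>] at0(1)])
    moreover have "(\<lambda>k. - (LINT x|lborel. \<phi> x * ((f (x + (- h k) *\<^sub>R e) - f x) / (- h k)))) \<longlonglongrightarrow>
        - (LINT x|lborel. \<phi> x * partial_deriv i f x)"
      unfolding e_def
      by (rule tendsto_minus[OF filterlim_compose[OF tendsto_integral_difference_quotient[OF \<phi>' f] at0(2)]])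
    ultimately have "(LINT x|lborel. f x * partial_deriv i \<phi> x) = - (LINT x|lborel. \<phi> x * partial_deriv i f x)"
      unfolding eq by (rule LIMSEQ_unique)
    then show ?thesis by (simp add: mult.commute)
  qed
  moreover have "locally_integrable (partial_deriv i f)"
    by (intro locally_integrable_continuous test_function_continuous test_function_partial_deriv f)
  ultimately show ?thesis by (simp add: is_weak_partial_def)
qed

lemma test_function_in_Lp:
  fixes f :: "real^'n \<Rightarrow> real"
  assumes f: "test_function f" and p: "p > 0"
  shows "in_Lp p f"
  unfolding in_Lp_def
proof
  show m: "f \<in> borel_measurable lborel" using test_function_measurable[OF f] by simp
  obtain B where B: "B > 0" "\<And>x. \<bar>f x\<bar> \<le> B" using test_function_bounded[OF f] by blast
  obtain R where R: "\<And>x. R < norm x \<Longrightarrow> f x = 0" using test_function_support[OF f] by blast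
  show "integrable lborel (\<lambda>x. \<bar>f x\<bar> powr p)"
  proof (rule Bochner_Integration.integrable_bound)
    show "integrable lborel (\<lambda>x::real^'n. B powr p * indicator (cball 0 R) x)"
      by (intro integrable_mult_right integrable_real_indicator) (auto simp: emeasure_bounded_finite[OF bounded_cball, unfolded infinity_ennreal_def])
    show "(\<lambda>x. \<bar>f x\<bar> powr p) \<in> borel_measurable lborel"
      by (intro powr_real_measurable borel_measurable_abs borel_measurable_const m)
    show "AE x in lborel. norm (\<bar>f x\<bar> powr p) \<le> norm (B powr p * indicator (cball 0 R) x)"
    proof (intro AE_I2)
      fix x
      show "norm (\<bar>f x\<bar> powr p) \<le> norm (B powr p * indicator (cball 0 R) x)"
        using R[of x] powr_mono2[OF less_imp_le[OF p] _ B(2)[of x]]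
        by (cases "R < norm x") auto
    qed
  qed
qed

lemma test_function_D1p:
  fixes f :: "real^'n \<Rightarrow> real"
  assumes f: "test_function f" and p: "real CARD('n) < p"
  shows "f \<in> D1p p"
proof -
  have p0: "p > 0" using p by linarith
  define \<alpha> where "\<alpha> = 1 - real CARD('n) / p"
  have \<alpha>: "0 < \<alpha>" "\<alpha> \<le> 1" using p p0 by (auto simp: \<alpha>_def divide_less_eq)
  obtain M where M: "M > 0" "\<And>x. \<bar>f x\<bar> \<le> M" using test_function_bounded[OF f] by blast
  have "\<exists>B. \<forall>x. \<bar>partial_deriv i f x\<bar> \<le> B" for i
    using test_function_bounded[OF test_function_partial_deriv[OF f, of i]] by blast
  then have "\<forall>i. \<exists>B. \<forall>x. \<bar>partial_deriv i f x\<bar> \<le> B" by blast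
  from choice[OF this] obtain B where B: "\<And>i x. \<bar>partial_deriv i f x\<bar> \<le> B i" by blast
  define C where "C = (\<Sum>i\<in>UNIV. B i)"
  have "B i \<ge> 0" for i using B[of i 0] by linarith
  then have C0: "C \<ge> 0" unfolding C_def by (intro sum_nonneg) auto
  \<comment> \<open>Changing one coordinate at a time adds up the one-dimensional mean value
    bounds.\<close>
  have step: "\<bar>f (y + (\<Sum>i\<in>I. c i *\<^sub>R axis i 1)) - f y\<bar> \<le> (\<Sum>i\<in>I. B i * \<bar>c i\<bar>)"
    if "finite I" for I y and c :: "'n \<Rightarrow> real"
    using that
  proof induction
    case (insert i I)
    define z where "z = y + (\<Sum>i\<in>I. c i *\<^sub>R axis i 1)"
    have "\<bar>f (z + c i *\<^sub>R axis i 1) - f z\<bar> \<le> B i * \<bar>c i\<bar>"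
      by (rule test_function_difference_bound[OF f B])
    with insert show ?case by (simp add: z_def ac_simps)
  qed simp
  have lip: "\<bar>f x - f y\<bar> \<le> C * norm (x - y)" for x y
  proof -
    have "\<bar>f x - f y\<bar> \<le> (\<Sum>i\<in>UNIV. B i * \<bar>(x - y) $ i\<bar>)"
      using step[of UNIV y "\<lambda>i. (x - y) $ i"] basis_expansion[of "x - y"]
      by (simp add: scalar_mult_eq_scaleR del: vector_minus_component)
    also have "\<dots> \<le> (\<Sum>i\<in>UNIV. B i * norm (x - y))"
      by (intro sum_mono mult_left_mono component_le_norm_cart \<open>\<And>i. B i \<ge> 0\<close>)
    finally show ?thesis by (simp add: C_def sum_distrib_right)
  qed
  \<comment> \<open>The Lipschitz constant \<open>C\<close> serves distances up to 1, where a
    smaller exponent only enlarges the power; the bound \<open>2 * M\<close> serves larger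
    distances, where the power is at least 1.\<close>
  have "\<bar>f x - f y\<bar> \<le> (C + 2 * M) * norm (x - y) powr \<alpha>" for x y
  proof (cases "norm (x - y) \<le> 1")
    case True
    have "norm (x - y) \<le> norm (x - y) powr \<alpha>"
    proof (cases "x = y")
      case False
      then show ?thesis
        using powr_mono'[of \<alpha> 1 "norm (x - y)"] True \<alpha> by simp
    qed simp
    then have "C * norm (x - y) \<le> (C + 2 * M) * norm (x - y) powr \<alpha>"
      using C0 M by (intro mult_mono) auto
    with lip[of x y] show ?thesis by linarith
  next
    case False
    then have "1 \<le> norm (x - y) powr \<alpha>"
      using \<alpha> by (intro ge_one_powr_ge_zero) auto
    then have "(C + 2 * M) * 1 \<le> (C + 2 * M) * norm (x - y) powr \<alpha>"
      using C0 M by (intro mult_left_mono) auto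
    moreover have "\<bar>f x - f y\<bar> \<le> 2 * M" using M(2)[of x] M(2)[of y] by linarith
    then have "\<bar>f x - f y\<bar> \<le> (C + 2 * M) * 1" using C0 by simp
    ultimately show ?thesis by (rule order_trans[rotated])
  qed
  then have "\<exists>L. \<forall>x y. \<bar>f x - f y\<bar> \<le> L * norm (x - y) powr \<alpha>" by blast
  moreover have "\<exists>v. is_weak_partial f i v \<and> in_Lp p v" for i
    using test_function_weak_partial[OF f] test_function_in_Lp[OF test_function_partial_deriv[OF f] p0] by blast
  moreover have "locally_integrable f"
    by (intro locally_integrable_continuous test_function_continuous f)
  ultimately show ?thesis by (simp add: D1p_def \<alpha>_def)
qed

section \<open>Signed measures under similarities\<close>

context
  fixes \<rho> :: "'a::second_countable_topology set \<Rightarrow> real"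
  assumes \<rho>: "signed_borel_measure \<rho>"
begin

lemma signed_borel_measure_empty: "\<rho> {} = 0"
  using \<rho> by (simp add: signed_borel_measure_def)

lemma signed_borel_measure_sums:
  fixes A :: "nat \<Rightarrow> 'a set"
  assumes "range A \<subseteq> sets borel" "disjoint_family A"
  shows "(\<lambda>k. \<rho> (A k)) sums \<rho> (\<Union>k. A k)"
  using \<rho> assms unfolding signed_borel_measure_def by blast

lemma signed_borel_measure_Un:
  assumes "A \<in> sets borel" "B \<in> sets borel" "A \<inter> B = {}"
  shows "\<rho> (A \<union> B) = \<rho> A + \<rho> B"
proof -
  have "(\<lambda>k. \<rho> (binaryset A B k)) sums \<rho> (\<Union>k. binaryset A B k)"
    using assms by (intro signed_borel_measure_sums)
      (auto simp: range_binaryset_eq disjoint_family_on_def binaryset_def)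
  moreover have "(\<lambda>k. \<rho> (binaryset A B k)) sums (\<rho> A + \<rho> B)"
    by (rule binaryset_sums[of \<rho>, OF signed_borel_measure_empty])
  ultimately show ?thesis
    using sums_unique2 by (simp add: UN_binaryset_eq)
qed

lemma signed_borel_measure_split:
  assumes "A \<in> sets borel" "B \<in> sets borel"
  shows "\<rho> A = \<rho> (A \<inter> B) + \<rho> (A - B)"
proof -
  have "\<rho> ((A \<inter> B) \<union> (A - B)) = \<rho> (A \<inter> B) + \<rho> (A - B)"
    by (rule signed_borel_measure_Un) (use assms in auto)
  then show ?thesis by (simp add: Int_Diff_Un)
qed

text \<open>\<open>measure_of\<close> returns the prescribed values only for a countably additive
  set function. Joining subsets of disjoint sets gives superadditivity and hence one inequality;
  cutting a subset of the union along the pieces gives the other.\<close>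

lemma emeasure_pos_variation:
  assumes A: "A \<in> sets borel"
  shows "emeasure (pos_variation \<rho>) A = (SUP B \<in> {B \<in> sets borel. B \<subseteq> A}. ennreal (\<rho> B))"
proof -
  define V where "V A = (SUP B \<in> {B \<in> sets borel. B \<subseteq> A}. ennreal (\<rho> B))" for A
  have V_upper: "ennreal (\<rho> B) \<le> V A" if "B \<in> sets borel" "B \<subseteq> A" for A B
    unfolding V_def using that by (intro SUP_upper) auto
  have V_mono: "V A \<le> V B" if "A \<subseteq> B" for A B
    unfolding V_def using that by (intro SUP_subset_mono) auto
  have V_Un: "V A + V B \<le> V (A \<union> B)" if "A \<inter> B = {}" for A B
  proof -
    have ne: "{B \<in> sets borel. B \<subseteq> A} \<noteq> {}" for A :: "'a set" by blast
    have "ennreal (\<rho> C) + ennreal (\<rho> D) \<le> V (A \<union> B)"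
      if C: "C \<in> sets borel" "C \<subseteq> A" and D: "D \<in> sets borel" "D \<subseteq> B" for C D
    proof -
      have "\<rho> (C \<union> D) = \<rho> C + \<rho> D"
        using C D \<open>A \<inter> B = {}\<close> by (intro signed_borel_measure_Un) auto
      then have "ennreal (\<rho> C) + ennreal (\<rho> D) = ennreal (\<rho> (C \<union> D))" if "\<rho> C \<ge> 0" "\<rho> D \<ge> 0"
        using that by simp
      moreover have "ennreal (\<rho> C) \<le> V (A \<union> B)" "ennreal (\<rho> D) \<le> V (A \<union> B)" "ennreal (\<rho> (C \<union> D)) \<le> V (A \<union> B)"
        using C D by (auto intro!: V_upper)
      ultimately show ?thesis
        \<comment> \<open>A negative value is truncated to 0, and then a bound on the other summand
          alone is enough.\<close>
        by (cases "\<rho> C \<ge> 0"; cases "\<rho> D \<ge> 0") (auto simp: ennreal_neg)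
    qed
    then show ?thesis
      unfolding V_def[of A] V_def[of B]
      by (auto simp: ennreal_SUP_add_left[OF ne, symmetric] ennreal_SUP_add_right[OF ne] intro!: SUP_least)
  qed
  have V_empty: "V {} = 0"
    unfolding V_def by (simp add: signed_borel_measure_empty Collect_conv_if conj_commute)
  have "emeasure (pos_variation \<rho>) A = V A"
    unfolding pos_variation_def V_def[symmetric]
  proof (rule emeasure_measure_of_sigma)
    show "sigma_algebra UNIV (sets (borel :: 'a measure))"
      using sets.sigma_algebra_axioms[of "borel :: 'a measure"] by simp
    show "positive (sets borel) V" by (simp add: positive_def V_empty)
    show "countably_additive (sets borel) V"
    proof (rule countably_additiveI)
      fix A :: "nat \<Rightarrow> 'a set"
      assume A: "range A \<subseteq> sets borel" "disjoint_family A"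
      show "(\<Sum>i. V (A i)) = V (\<Union>i. A i)"
      proof (rule antisym)
        have "(\<Sum>i<n. V (A i)) \<le> V (\<Union>i<n. A i)" for n
        proof (induction n)
          case (Suc n)
          have "(\<Union>i<n. A i) \<inter> A n = {}"
            using disjoint_family_onD[OF A(2), of _ n] by fastforce
          then have "V (\<Union>i<n. A i) + V (A n) \<le> V ((\<Union>i<n. A i) \<union> A n)" by (rule V_Un)
          with add_right_mono[OF Suc, of "V (A n)"]
          have "(\<Sum>i<n. V (A i)) + V (A n) \<le> V ((\<Union>i<n. A i) \<union> A n)" by (rule order_trans)
          then show ?case by (simp add: lessThan_Suc Un_commute add.commute)
        qed (simp add: V_empty)
        also have "V (\<Union>i<n. A i) \<le> V (\<Union>i. A i)" for n by (intro V_mono) auto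
        finally show "(\<Sum>i. V (A i)) \<le> V (\<Union>i. A i)"
          by (intro suminf_le_const) auto
      next
        show "V (\<Union>i. A i) \<le> (\<Sum>i. V (A i))"
          unfolding V_def[of "\<Union>i. A i"]
        proof (rule SUP_least, safe)
          fix B assume B: "B \<in> sets borel" "B \<subseteq> (\<Union>i. A i)"
          \<comment> \<open>Along the pieces of B the signed sum may contain negative terms;
            replacing them by 0 only increases the partial sums and brings them under the values
            \<open>V (A i)\<close>.\<close>
          have "(\<lambda>i. \<rho> (B \<inter> A i)) sums \<rho> (\<Union>i. B \<inter> A i)"
            by (rule signed_borel_measure_sums) (use A B in \<open>auto simp: disjoint_family_on_def\<close>)
          also have "(\<Union>i. B \<inter> A i) = B" using B by auto
          finally have "(\<lambda>n. ennreal (\<Sum>i<n. \<rho> (B \<inter> A i))) \<longlonglongrightarrow> ennreal (\<rho> B)"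
            unfolding sums_def by (rule tendsto_ennrealI)
          moreover have "ennreal (\<Sum>i<n. \<rho> (B \<inter> A i)) \<le> (\<Sum>i. V (A i))" for n
          proof -
            have "ennreal (\<Sum>i<n. \<rho> (B \<inter> A i)) \<le> ennreal (\<Sum>i<n. max 0 (\<rho> (B \<inter> A i)))"
              by (intro ennreal_leI sum_mono) simp
            also have "\<dots> = (\<Sum>i<n. ennreal (max 0 (\<rho> (B \<inter> A i))))"
              by (rule sum_ennreal[symmetric]) simp
            also have "\<dots> \<le> (\<Sum>i<n. V (A i))"
            proof (rule sum_mono)
              fix i
              have "ennreal (max 0 (\<rho> (B \<inter> A i))) = ennreal (\<rho> (B \<inter> A i))"
                by (simp add: max_def ennreal_neg)
              also have "\<dots> \<le> V (A i)" using A B by (intro V_upper) auto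
              finally show "ennreal (max 0 (\<rho> (B \<inter> A i))) \<le> V (A i)" .
            qed
            also have "\<dots> \<le> (\<Sum>i. V (A i))" by (intro sum_le_suminf) auto
            finally show ?thesis .
          qed
          ultimately show "ennreal (\<rho> B) \<le> (\<Sum>i. V (A i))"
            by (intro LIMSEQ_le_const2) auto
        qed
      qed
    qed
  qed (rule A)
  then show ?thesis by (simp add: V_def)
qed

text \<open>If the values were unbounded, one could split off disjoint sets of measure at least \<open>1\<close>
  in absolute value forever, always keeping a remainder on which the values are unbounded.\<close>

lemma signed_borel_measure_bounded:
  obtains c where "\<And>B. B \<in> sets borel \<Longrightarrow> \<bar>\<rho> B\<bar> \<le> c"
proof (rule ccontr)
  assume "\<not> thesis"
  define bad where "bad A \<longleftrightarrow> A \<in> sets borel \<and> (\<forall>c. \<exists>B\<in>sets borel. B \<subseteq> A \<and> c < \<bar>\<rho> B\<bar>)" for A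
  have "bad UNIV"
    using \<open>\<not> thesis\<close> that unfolding bad_def by (metis not_le sets.top space_borel top_greatest)
  have bad_split: "bad B \<or> bad (A - B)" if AB: "bad A" "B \<in> sets borel" "B \<subseteq> A" for A B
  proof (rule ccontr)
    assume "\<not> ?thesis"
    moreover have "A - B \<in> sets borel" using AB by (auto simp: bad_def)
    ultimately obtain c d where
      c: "\<And>C. C \<in> sets borel \<Longrightarrow> C \<subseteq> B \<Longrightarrow> \<bar>\<rho> C\<bar> \<le> c" and
      d: "\<And>C. C \<in> sets borel \<Longrightarrow> C \<subseteq> A - B \<Longrightarrow> \<bar>\<rho> C\<bar> \<le> d"
      using AB(2) unfolding bad_def by (meson not_le)
    obtain C where C: "C \<in> sets borel" "C \<subseteq> A" "c + d < \<bar>\<rho> C\<bar>"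
      using AB(1) unfolding bad_def by blast
    have "\<bar>\<rho> (C \<inter> B)\<bar> \<le> c" "\<bar>\<rho> (C - B)\<bar> \<le> d"
      using C AB(2) by (auto intro!: c d)
    then show False
      using signed_borel_measure_split[OF C(1) AB(2)] C(3) by linarith
  qed
  have step: "\<exists>A'. bad A' \<and> A' \<subseteq> A \<and> 1 \<le> \<bar>\<rho> (A - A')\<bar>" if A: "bad A" for A
  proof -
    \<comment> \<open>With this margin both B and \<open>A - B\<close> have measure at least 1 in
      absolute value, so either one can be split off and the bad one kept.\<close>
    obtain B where B: "B \<in> sets borel" "B \<subseteq> A" "\<bar>\<rho> A\<bar> + 1 < \<bar>\<rho> B\<bar>"
      using A unfolding bad_def by blast
    have "A \<in> sets borel" using A by (simp add: bad_def)
    moreover have "A \<inter> B = B" using B(2) by blast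
    ultimately have "\<rho> A = \<rho> B + \<rho> (A - B)"
      using signed_borel_measure_split[of A B] B(1) by simp
    then have "1 \<le> \<bar>\<rho> (A - B)\<bar>" "1 \<le> \<bar>\<rho> B\<bar>" using B(3) by linarith+
    moreover have "A - (A - B) = B" using B(2) by blast
    ultimately show ?thesis
      using bad_split[OF A B(1,2)] B(2) by (metis Diff_subset)
  qed
  obtain A where A: "\<And>n. bad (A n)" "\<And>n. A (Suc n) \<subseteq> A n" "\<And>n. 1 \<le> \<bar>\<rho> (A n - A (Suc n))\<bar>"
    using dependent_nat_choice[of "\<lambda>_. bad" "\<lambda>_ A A'. A' \<subseteq> A \<and> 1 \<le> \<bar>\<rho> (A - A')\<bar>"]
      \<open>bad UNIV\<close> step by metis
  \<comment> \<open>Complements turn the decreasing sequence into an increasing one, for which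
    successive differences are disjoint. The terms of the resulting convergent series cannot all
    have absolute value at least 1.\<close>
  have "disjoint_family (\<lambda>n. (- A (Suc n)) - (- A n))"
    by (rule disjoint_family_Suc) (use A(2) in auto)
  moreover have "(- A (Suc n)) - (- A n) = A n - A (Suc n)" for n by auto
  ultimately have "(\<lambda>n. \<rho> (A n - A (Suc n))) sums \<rho> (\<Union>n. A n - A (Suc n))"
    using A(1) by (intro signed_borel_measure_sums) (auto simp: bad_def)
  then have "(\<lambda>n. \<rho> (A n - A (Suc n))) \<longlonglongrightarrow> 0"
    using sums_summable summable_LIMSEQ_zero by blast
  then have "eventually (\<lambda>n. \<bar>\<rho> (A n - A (Suc n))\<bar> < 1) sequentially"
    using tendstoD[of "\<lambda>n. \<rho> (A n - A (Suc n))" 0 sequentially 1] by (simp add: dist_real_def)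
  then obtain N where "\<bar>\<rho> (A N - A (Suc N))\<bar> < 1"
    unfolding eventually_sequentially by blast
  with A(3)[of N] show False by simp
qed

lemma finite_measure_pos_variation: "finite_measure (pos_variation \<rho>)"
proof
  obtain c where c: "\<And>B. B \<in> sets borel \<Longrightarrow> \<bar>\<rho> B\<bar> \<le> c"
    using signed_borel_measure_bounded by blast
  have "emeasure (pos_variation \<rho>) UNIV = (SUP B \<in> {B \<in> sets borel. B \<subseteq> UNIV}. ennreal (\<rho> B))"
    by (rule emeasure_pos_variation) simp
  also have "\<dots> \<le> ennreal c"
    by (rule SUP_least) (use c in \<open>force intro: ennreal_leI\<close>)
  finally have "emeasure (pos_variation \<rho>) UNIV \<le> ennreal c" .
  then show "emeasure (pos_variation \<rho>) (space (pos_variation \<rho>)) \<noteq> \<infinity>"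
    by (auto simp: pos_variation_def space_measure_of_conv top_unique)
qed

end

lemma sets_pos_variation [simp, measurable_cong]: "sets (pos_variation \<rho>) = sets borel"
  unfolding pos_variation_def
  using sets.sets_measure_of_eq[of borel] by simp

lemma space_pos_variation [simp]: "space (pos_variation \<rho>) = UNIV"
  by (simp add: pos_variation_def space_measure_of_conv)

lemma sets_neg_variation [simp, measurable_cong]: "sets (neg_variation \<rho>) = sets borel"
  by (simp add: neg_variation_def)

lemma space_neg_variation [simp]: "space (neg_variation \<rho>) = UNIV"
  by (simp add: neg_variation_def)

lemma signed_borel_measure_minus:
  "signed_borel_measure \<rho> \<Longrightarrow> signed_borel_measure (\<lambda>A. - \<rho> A)"
  by (auto simp: signed_borel_measure_def intro: sums_minus)

lemma finite_measure_neg_variation: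
  fixes \<rho> :: "'a::second_countable_topology set \<Rightarrow> real"
  shows "signed_borel_measure \<rho> \<Longrightarrow> finite_measure (neg_variation \<rho>)"
  unfolding neg_variation_def by (intro finite_measure_pos_variation signed_borel_measure_minus)

text \<open>Total mass 0 gives \<open>\<rho> (- B) = - \<rho> B\<close>, so complementation
  exchanges the suprema that define the two variations, and their total masses coincide.\<close>

lemma signed_integral_const:
  fixes \<rho> :: "'a::second_countable_topology set \<Rightarrow> real" and c :: real
  assumes \<rho>: "signed_borel_measure \<rho>" and 0: "\<rho> UNIV = 0"
  shows "signed_integral \<rho> (\<lambda>_. c) = 0"
proof -
  have compl: "\<rho> (- B) = - \<rho> B" if "B \<in> sets borel" for B
    using signed_borel_measure_split[OF \<rho>, of UNIV B] that 0 by (simp add: Compl_eq_Diff_UNIV)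
  have "emeasure (pos_variation \<rho>) UNIV = emeasure (neg_variation \<rho>) UNIV"
    unfolding neg_variation_def
      emeasure_pos_variation[OF \<rho> sets.top[of borel, unfolded space_borel]]
      emeasure_pos_variation[OF signed_borel_measure_minus[OF \<rho>] sets.top[of borel, unfolded space_borel]]
  proof (rule SUP_eq)
    fix B :: "'a set" assume "B \<in> {B \<in> sets borel. B \<subseteq> UNIV}"
    then show "\<exists>C\<in>{B \<in> sets borel. B \<subseteq> UNIV}. ennreal (\<rho> B) \<le> ennreal (- \<rho> C)"
      and "\<exists>C\<in>{B \<in> sets borel. B \<subseteq> UNIV}. ennreal (- \<rho> B) \<le> ennreal (\<rho> C)"
      by (auto intro!: bexI[of _ "- B"] simp: compl borel_comp)
  qed
  then show ?thesis
    by (simp add: signed_integral_def measure_def)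
qed

section \<open>Concentration on the support\<close>

text \<open>The complement of the support is a union of open null sets; by the Lindelof property
  countably many of them suffice.\<close>

lemma AE_signed_support:
  fixes \<rho> :: "'a::second_countable_topology set \<Rightarrow> real"
  shows "AE x in pos_variation \<rho>. x \<in> signed_support \<rho>" "AE x in neg_variation \<rho>. x \<in> signed_support \<rho>"
proof -
  define F where "F = {U. open U \<and> emeasure (pos_variation \<rho>) U + emeasure (neg_variation \<rho>) U = 0}"
  obtain F' where F': "F' \<subseteq> F" "countable F'" "\<Union>F' = \<Union>F"
    using Lindelof[of F] by (auto simp: F_def)
  have eq: "{x. x \<notin> signed_support \<rho>} = \<Union>F'"
    unfolding F'(3) by (auto simp: signed_support_def F_def)
  have null: "\<Union>F' \<in> null_sets M" if "\<And>U. U \<in> F' \<Longrightarrow> U \<in> null_sets M" for M :: "'a measure"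
    using null_sets_UN'[OF F'(2), of "\<lambda>U. U" M] that by simp
  have "\<Union>F' \<in> null_sets (pos_variation \<rho>)" "\<Union>F' \<in> null_sets (neg_variation \<rho>)"
    using F'(1) by (auto simp: F_def intro!: null null_setsI)
  then show "AE x in pos_variation \<rho>. x \<in> signed_support \<rho>" "AE x in neg_variation \<rho>. x \<in> signed_support \<rho>"
    using eq by (auto intro!: AE_I')
qed

lemma signed_integral_cong_support:
  fixes f g :: "'a::second_countable_topology \<Rightarrow> real"
  assumes "f \<in> borel_measurable borel" "g \<in> borel_measurable borel"
    and "\<And>x. x \<in> signed_support \<rho> \<Longrightarrow> f x = g x"
  shows "signed_integral \<rho> f = signed_integral \<rho> g"
proof -
  have "AE x in pos_variation \<rho>. f x = g x" "AE x in neg_variation \<rho>. f x = g x"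
    using AE_signed_support[of \<rho>] assms(3) by auto
  then show ?thesis
    using assms(1,2) unfolding signed_integral_def
    by (intro arg_cong2[where f = "(-)"] integral_cong_AE) auto
qed

text \<open>If the support were empty, both variations would be concentrated on the empty set and
  all integrals would vanish. This supplies a point where the minimum over the support can be
  attained.\<close>

lemma signed_support_nonempty:
  assumes "signed_integral \<rho> (f :: 'a::second_countable_topology \<Rightarrow> 'b::{banach, second_countable_topology}) \<noteq> 0"
  shows "signed_support \<rho> \<noteq> {}"
proof
  assume *: "signed_support \<rho> = {}"
  have "integral\<^sup>L M f = 0" if "AE x in M. x \<in> signed_support \<rho>" for M :: "'a measure"
    using that unfolding * by (intro integral_eq_zero_AE) auto
  with AE_signed_support[of \<rho>] assms show False
    by (simp add: signed_integral_def)
qed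

section \<open>Push forward under similarities\<close>

text \<open>The inverse is x -> (1/c) Q^T (x - z). The push-forward lemmas need no more of a
  similarity than this pair of mutually inverse continuous maps.\<close>

lemma similarities_inverse:
  assumes "S \<in> similarities"
  obtains T where "continuous_on UNIV S" "continuous_on UNIV T" "\<And>x. S (T x) = x" "\<And>x. T (S x) = x"
proof -
  obtain c Q z where c: "c > 0" and Q: "orthogonal_matrix Q" and S: "S = (\<lambda>y. c *\<^sub>R (Q *v y) + z)"
    using assms by (auto simp: similarities_def)
  define T where "T x = (1 / c) *\<^sub>R (transpose Q *v (x - z))" for x
  show thesis
  proof
    show "continuous_on UNIV S"
      unfolding S by (intro continuous_intros matrix_vector_mult_linear_continuous_on)
    show "continuous_on UNIV T"
      unfolding T_def[abs_def]
      by (intro continuous_intros continuous_on_compose2[OF matrix_vector_mult_linear_continuous_on[of UNIV]]) auto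
    show "S (T x) = x" for x
      using c Q by (simp add: S T_def matrix_vector_mul_assoc orthogonal_matrix_def
          matrix_vector_mult_scaleR del: transpose_matrix_vector)
    show "T (S x) = x" for x
      using c Q by (simp add: S T_def matrix_vector_mul_assoc orthogonal_matrix_def
          matrix_vector_mult_scaleR del: transpose_matrix_vector)
  qed
qed

lemma id_similarity: "(\<lambda>x. x) \<in> similarities"
  unfolding similarities_def
  by (intro CollectI exI[of _ 1] exI[of _ "mat 1"] exI[of _ 0]) (simp add: orthogonal_matrix_id)

context
  fixes \<rho> :: "'a::second_countable_topology set \<Rightarrow> real" and S T :: "'a \<Rightarrow> 'a"
  assumes \<rho>: "signed_borel_measure \<rho>"
    and S: "continuous_on UNIV S" and T: "continuous_on UNIV T"
    and ST: "\<And>x. S (T x) = x" and TS: "\<And>x. T (S x) = x"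
begin

lemma vimage_borel_S: "A \<in> sets borel \<Longrightarrow> S -` A \<in> sets borel"
  using measurable_sets_borel[OF borel_measurable_continuous_onI[OF S]] .

lemma vimage_borel_T: "A \<in> sets borel \<Longrightarrow> T -` A \<in> sets borel"
  using measurable_sets_borel[OF borel_measurable_continuous_onI[OF T]] .

lemma signed_borel_measure_push_forward: "signed_borel_measure (push_forward S \<rho>)"
  unfolding signed_borel_measure_def push_forward_def
proof safe
  show "\<rho> (S -` {}) = 0" using signed_borel_measure_empty[OF \<rho>] by simp
  fix A :: "nat \<Rightarrow> 'a set" assume "range A \<subseteq> sets borel" "disjoint_family A"
  then show "(\<lambda>k. \<rho> (S -` A k)) sums \<rho> (S -` (\<Union>k. A k))"
    unfolding vimage_UN
    by (intro signed_borel_measure_sums[OF \<rho>]) (auto simp: disjoint_family_on_def intro!: vimage_borel_S)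
qed

lemma emeasure_pos_variation_push_forward:
  assumes A: "A \<in> sets borel"
  shows "emeasure (pos_variation (push_forward S \<rho>)) A = emeasure (pos_variation \<rho>) (S -` A)"
  unfolding emeasure_pos_variation[OF signed_borel_measure_push_forward A]
    emeasure_pos_variation[OF \<rho> vimage_borel_S[OF A]]
proof (rule SUP_eq)
  fix B assume "B \<in> {B \<in> sets borel. B \<subseteq> A}"
  then show "\<exists>C\<in>{B \<in> sets borel. B \<subseteq> S -` A}. ennreal (push_forward S \<rho> B) \<le> ennreal (\<rho> C)"
    by (intro bexI[of _ "S -` B"]) (auto simp: push_forward_def vimage_borel_S)
next
  fix B assume B: "B \<in> {B \<in> sets borel. B \<subseteq> S -` A}"
  have "S -` (T -` B) = B" by (auto simp: TS)
  moreover have "T -` B \<subseteq> A" using B ST by (metis (no_types, lifting) mem_Collect_eq subset_iff vimage_eq)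
  ultimately show "\<exists>C\<in>{B \<in> sets borel. B \<subseteq> A}. ennreal (\<rho> B) \<le> ennreal (push_forward S \<rho> C)"
    using B by (intro bexI[of _ "T -` B"]) (auto simp: push_forward_def vimage_borel_T)
qed

end

lemma signed_support_push_forward:
  fixes \<rho> :: "'a::second_countable_topology set \<Rightarrow> real" and S T :: "'a \<Rightarrow> 'a"
  assumes \<rho>: "signed_borel_measure \<rho>"
    and S: "continuous_on UNIV S" and T: "continuous_on UNIV T"
    and ST: "\<And>x. S (T x) = x" and TS: "\<And>x. T (S x) = x"
  shows "signed_support (push_forward S \<rho>) = S ` signed_support \<rho>"
proof -
  have neg: "neg_variation (push_forward S \<rho>) = pos_variation (push_forward S (\<lambda>A. - \<rho> A))"
    by (simp add: neg_variation_def push_forward_def)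
  have eq: "emeasure (pos_variation (push_forward S \<rho>)) U + emeasure (neg_variation (push_forward S \<rho>)) U =
      emeasure (pos_variation \<rho>) (S -` U) + emeasure (neg_variation \<rho>) (S -` U)" if "open U" for U
    unfolding neg unfolding neg_variation_def
    using that emeasure_pos_variation_push_forward[OF \<rho> S T ST TS, of U]
      emeasure_pos_variation_push_forward[OF signed_borel_measure_minus[OF \<rho>] S T ST TS, of U]
    by simp
  have oS: "open (S -` U)" and oT: "open (T -` U)" if "open U" for U
    using that S T by (simp_all add: open_vimage)
  show ?thesis
  proof (intro equalityI subsetI)
    fix x assume x: "x \<in> signed_support (push_forward S \<rho>)"
    have "T x \<in> signed_support \<rho>"
      unfolding signed_support_def
    proof safe
      fix U assume U: "open U" "T x \<in> U"
        and 0: "emeasure (pos_variation \<rho>) U + emeasure (neg_variation \<rho>) U = 0"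
      have "S -` (T -` U) = U" by (auto simp: TS)
      then show False
        using x U 0 eq[OF oT[OF U(1)]] oT[OF U(1)] unfolding signed_support_def by auto
    qed
    then show "x \<in> S ` signed_support \<rho>" using ST[of x] by (metis imageI)
  next
    fix x assume "x \<in> S ` signed_support \<rho>"
    then show "x \<in> signed_support (push_forward S \<rho>)"
      unfolding signed_support_def using oS eq by auto
  qed
qed

text \<open>Some coordinate has nonzero integral against \<open>\<rho>\<close>, but its gradient is
  constant and hence not in L^p. Cutting it off by bumps on a box around the support gives members
  of \<open>D1p\<close> whose integrals converge to that of the coordinate; they cannot all
  vanish.\<close>

lemma exists_D1p_signed_integral_nonzero:
  fixes \<rho> :: "(real^'n) set \<Rightarrow> real"
  assumes \<rho>: "admissible_measure \<rho>" and p: "real CARD('n) < p"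
  shows "\<exists>f\<in>D1p p. signed_integral \<rho> f \<noteq> 0"
proof (rule ccontr)
  assume contr: "\<not> ?thesis"
  have sm: "signed_borel_measure \<rho>" using \<rho> by (simp add: admissible_measure_def)
  have "compact (signed_support \<rho>)" using \<rho> by (simp add: admissible_measure_def)
  then obtain R where R: "\<And>x. x \<in> signed_support \<rho> \<Longrightarrow> norm x \<le> R"
    using compact_imp_bounded bounded_iff by metis
  interpret pos: finite_measure "pos_variation \<rho>" by (rule finite_measure_pos_variation[OF sm])
  interpret neg: finite_measure "neg_variation \<rho>" by (rule finite_measure_neg_variation[OF sm])
  have ae: "AE x in pos_variation \<rho>. norm x \<le> R" "AE x in neg_variation \<rho>. norm x \<le> R"
    using AE_signed_support[of \<rho>] R by auto
  have int: "integrable (pos_variation \<rho>) (\<lambda>x. x)" "integrable (neg_variation \<rho>) (\<lambda>x. x)"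
    using ae by (auto intro!: pos.integrable_const_bound[of _ R] neg.integrable_const_bound[of _ R])
  \<comment> \<open>The margin 1 places the closed ball containing the support inside the open box,
    where the bumps tend to 1.\<close>
  define a b :: "real^'n" where "a = (\<chi> i. - (R + 1))" and "b = (\<chi> i. R + 1)"
  have box: "x \<in> box a b" if "norm x \<le> R" for x
  proof -
    have "\<bar>x $ i\<bar> < R + 1" for i using component_le_norm_cart[of x i] that by linarith
    then have "- (R + 1) < x $ i \<and> x $ i < R + 1" for i by (metis abs_less_iff minus_less_iff)
    then show ?thesis unfolding mem_box_cart a_def b_def vec_lambda_beta by blast
  qed
  have lim: "(\<lambda>k. integral\<^sup>L M (\<lambda>x. x $ j * bump a b k x)) \<longlonglongrightarrow> integral\<^sup>L M (\<lambda>x. x $ j)"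
    if M: "finite_measure M" "sets M = sets borel" "AE x in M. norm x \<le> R" for M j
  proof -
    interpret M: finite_measure M by fact
    have "(\<lambda>x. x $ j) \<in> borel_measurable borel"
      by (intro borel_measurable_continuous_onI continuous_intros)
    moreover have "(\<lambda>x. x $ j * bump a b k x) \<in> borel_measurable borel" for k
      by (rule test_function_measurable[OF test_function_coord_bump])
    ultimately have meas: "(\<lambda>x. x $ j) \<in> borel_measurable M"
      "\<And>k. (\<lambda>x. x $ j * bump a b k x) \<in> borel_measurable M"
      by (simp_all add: measurable_cong_sets[OF M(2) refl])
    show ?thesis
    proof (rule integral_dominated_convergence[where w = "\<lambda>_. R"])
      show "AE x in M. (\<lambda>k. x $ j * bump a b k x) \<longlonglongrightarrow> x $ j"
        using M(3)
      proof eventually_elim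
        case (elim x)
        have "(\<lambda>k. x $ j * bump a b k x) \<longlonglongrightarrow> x $ j * indicator (box a b) x"
          by (intro tendsto_intros bump_tendsto)
        then show ?case using box[OF elim] by simp
      qed
      show "AE x in M. norm (x $ j * bump a b k x) \<le> R" for k
        using M(3)
      proof eventually_elim
        case (elim x)
        have "\<bar>x $ j\<bar> * \<bar>bump a b k x\<bar> \<le> R * 1"
          using component_le_norm_cart[of x j] elim bump_bounds[of a b k x]
          by (intro mult_mono) auto
        then show ?case by (simp add: abs_mult)
      qed
    qed (simp_all add: meas)
  qed
  have "signed_integral \<rho> (\<lambda>y. y) $ j = 0" for j
  proof -
    have "signed_integral \<rho> (\<lambda>y. y) $ j =
        integral\<^sup>L (pos_variation \<rho>) (\<lambda>x. x $ j) - integral\<^sup>L (neg_variation \<rho>) (\<lambda>x. x $ j)"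
      using integral_bounded_linear[OF bounded_linear_vec_nth int(1)]
        integral_bounded_linear[OF bounded_linear_vec_nth int(2)]
      by (simp add: signed_integral_def)
    moreover have "(\<lambda>k. signed_integral \<rho> (\<lambda>x. x $ j * bump a b k x)) \<longlonglongrightarrow>
        integral\<^sup>L (pos_variation \<rho>) (\<lambda>x. x $ j) - integral\<^sup>L (neg_variation \<rho>) (\<lambda>x. x $ j)"
      unfolding signed_integral_def
      by (intro tendsto_diff lim ae pos.finite_measure_axioms neg.finite_measure_axioms) simp_all
    moreover have "signed_integral \<rho> (\<lambda>x. x $ j * bump a b k x) = 0" for k
      using contr test_function_D1p[OF test_function_coord_bump p] by blast
    ultimately show ?thesis by (simp add: LIMSEQ_const_iff)
  qed
  then have "signed_integral \<rho> (\<lambda>y. y) = 0" by (simp add: vec_eq_iff)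
  with \<rho> show False by (simp add: admissible_measure_def)
qed

section \<open>Truncating an extremal\<close>

text \<open>\<open>LEAST\<close> satisfies its defining inequality only if a least constant exists.
  The infimum of the admissible constants is shown to be admissible: for positive gradient norm by
  dividing, and for zero gradient norm because the function is constant and, the total mass being 0,
  has seminorm 0.\<close>

lemma morrey_constant_bound:
  fixes \<rho> :: "(real^'n) set \<Rightarrow> real"
  assumes \<rho>: "admissible_measure \<rho>" and p: "real CARD('n) < p" and u: "u \<in> D1p p"
  shows "morrey_seminorm p \<rho> u \<le> morrey_constant p \<rho> * ennreal (grad_norm p u)"
proof -
  have sm: "signed_borel_measure \<rho>" "\<rho> UNIV = 0" using \<rho> by (auto simp: admissible_measure_def)
  define A where "A = {C. \<forall>u \<in> D1p p. morrey_seminorm p \<rho> u \<le> C * ennreal (grad_norm p u)}"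
  have 0: "morrey_seminorm p \<rho> w = 0" if w: "w \<in> D1p p" "grad_norm p w = 0" for w
  proof -
    have "w = (\<lambda>_. w 0)"
      using grad_norm_0_imp_const[OF w(1) p w(2)] by blast
    moreover have "morrey_quotient p (push_forward S \<rho>) (\<lambda>_. w 0) = 0" if S: "S \<in> similarities" for S
    proof -
      obtain T where "continuous_on UNIV S" "continuous_on UNIV T" "\<And>x. S (T x) = x" "\<And>x. T (S x) = x"
        using similarities_inverse[OF S] by blast
      then have "signed_borel_measure (push_forward S \<rho>)"
        using signed_borel_measure_push_forward[OF sm(1)] by blast
      moreover have "push_forward S \<rho> UNIV = 0" using sm(2) by (simp add: push_forward_def)
      ultimately show ?thesis
        unfolding morrey_quotient_def by (simp add: signed_integral_const)
    qed
    ultimately have "ennreal (morrey_quotient p (push_forward S \<rho>) w) = 0" if "S \<in> similarities" for S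
      using that by (metis ennreal_0)
    then show ?thesis
      unfolding morrey_seminorm_def by (intro antisym SUP_least) auto
  qed
  have "Inf A \<in> A"
    unfolding A_def
  proof (intro CollectI ballI, fold A_def)
    fix w :: "real^'n \<Rightarrow> real" assume w: "w \<in> D1p p"
    show "morrey_seminorm p \<rho> w \<le> Inf A * ennreal (grad_norm p w)"
    proof (cases "grad_norm p w = 0")
      case False
      define g where "g = ennreal (grad_norm p w)"
      have "grad_norm p w > 0" using False by (auto simp: grad_norm_def)
      then have g: "g \<noteq> 0" "g \<noteq> top" "g < top" by (auto simp: g_def)
      have "morrey_seminorm p \<rho> w / g \<le> Inf A"
      proof (rule Inf_greatest)
        fix C assume "C \<in> A"
        then have "morrey_seminorm p \<rho> w \<le> C * g" using w by (simp add: A_def g_def)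
        then have "morrey_seminorm p \<rho> w / g \<le> C * g / g" by (rule divide_right_mono_ennreal)
        then show "morrey_seminorm p \<rho> w / g \<le> C" using g by (simp add: mult_divide_eq_ennreal)
      qed
      then have "morrey_seminorm p \<rho> w / g * g \<le> Inf A * g" by (rule mult_right_mono) simp
      then show ?thesis using g by (simp add: ennreal_divide_times flip: g_def)
    qed (simp add: 0 w)
  qed
  moreover have "morrey_constant p \<rho> = Inf A"
    unfolding morrey_constant_def
  proof (rule Least_equality)
    show "\<forall>u\<in>D1p p. morrey_seminorm p \<rho> u \<le> Inf A * ennreal (grad_norm p u)"
      using \<open>Inf A \<in> A\<close> by (simp add: A_def)
    show "Inf A \<le> C" if "\<forall>u\<in>D1p p. morrey_seminorm p \<rho> u \<le> C * ennreal (grad_norm p u)" for C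
      using that by (intro Inf_lower) (simp add: A_def)
  qed
  ultimately show ?thesis using u by (simp add: A_def)
qed

lemma morrey_seminorm_pos:
  fixes \<rho> :: "(real^'n) set \<Rightarrow> real"
  assumes \<rho>: "admissible_measure \<rho>" and f: "signed_integral \<rho> f \<noteq> 0"
  shows "0 < morrey_seminorm p \<rho> f"
proof -
  have "0 < morrey_quotient p \<rho> f"
    using \<rho> f by (simp add: morrey_quotient_def admissible_measure_def)
  moreover have "push_forward (\<lambda>x. x) \<rho> = \<rho>" by (simp add: push_forward_def)
  ultimately have "0 < ennreal (morrey_quotient p (push_forward (\<lambda>x. x) \<rho>) f)" by simp
  also have "\<dots> \<le> morrey_seminorm p \<rho> f"
    unfolding morrey_seminorm_def by (intro SUP_upper id_similarity)
  finally show ?thesis .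
qed

lemma extremal_min:
  fixes \<rho> :: "(real^'n) set \<Rightarrow> real"
  assumes p: "real CARD('n) < p" and \<rho>: "admissible_measure \<rho>" and S: "S \<in> similarities"
    and \<mu>: "\<mu> = push_forward S \<rho>" and ext: "morrey_extremal p \<rho> u"
    and att: "morrey_seminorm p \<rho> u = ennreal (morrey_quotient p \<mu> u)"
  shows "\<exists>a\<in>signed_support \<mu>. \<forall>x. u a \<le> u x"
proof -
  have u: "u \<in> D1p p" and eq: "morrey_seminorm p \<rho> u = morrey_constant p \<rho> * ennreal (grad_norm p u)"
    using ext by (auto simp: morrey_extremal_def)
  have c: "continuous_on UNIV u" by (rule D1p_continuous[OF u p])
  have sm: "signed_borel_measure \<rho>" "compact (signed_support \<rho>)" "signed_integral \<rho> (\<lambda>y. y) \<noteq> 0"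
    using \<rho> by (auto simp: admissible_measure_def)
  obtain T where T: "continuous_on UNIV S" "continuous_on UNIV T" "\<And>x. S (T x) = x" "\<And>x. T (S x) = x"
    using similarities_inverse[OF S] by blast
  have supp: "signed_support \<mu> = S ` signed_support \<rho>"
    unfolding \<mu> by (rule signed_support_push_forward[OF sm(1) T])
  have "compact (signed_support \<mu>)"
    unfolding supp by (intro compact_continuous_image sm(2) continuous_on_subset[OF T(1)]) simp
  moreover have ne: "signed_support \<mu> \<noteq> {}"
    unfolding supp using signed_support_nonempty[OF sm(3)] by simp
  ultimately obtain a where a: "a \<in> signed_support \<mu>" "\<And>y. y \<in> signed_support \<mu> \<Longrightarrow> u a \<le> u y"
    using continuous_attains_inf[of "signed_support \<mu>" u] continuous_on_subset[OF c] by blast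
  show ?thesis
  proof (cases "grad_norm p u = 0")
    \<comment> \<open>A constant function attains its minimum at every point. The case is separate
      because infinity times 0 is 0, so the finiteness argument for the sharp constant fails
      here.\<close>
    case True
    then show ?thesis
      using a(1) grad_norm_0_imp_const[OF u p] by (metis order_refl)
  next
    case False
    then have g: "grad_norm p u > 0" by (auto simp: grad_norm_def)
    define C where "C = morrey_constant p \<rho>"
    have bound: "morrey_seminorm p \<rho> w \<le> C * ennreal (grad_norm p w)" if "w \<in> D1p p" for w
      unfolding C_def by (rule morrey_constant_bound[OF \<rho> p that])
    have C_top: "C \<noteq> top"
    proof
      assume "C = top"
      then have "morrey_seminorm p \<rho> u = top"
        unfolding eq C_def[symmetric] using g by (simp add: ennreal_top_mult)
      with att show False by simp
    qed
    obtain f where "f \<in> D1p p" "signed_integral \<rho> f \<noteq> 0"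
      using exists_D1p_signed_integral_nonzero[OF \<rho> p] by blast
    then have C_0: "C \<noteq> 0"
      using bound[of f] morrey_seminorm_pos[OF \<rho>, of f p] by auto
    define w where "w = (\<lambda>x. max (u x) (u a))"
    have w: "w \<in> D1p p" unfolding w_def by (rule D1p_max[OF u p])
    have "signed_integral \<mu> w = signed_integral \<mu> u"
    proof (rule signed_integral_cong_support)
      show "w \<in> borel_measurable borel" "u \<in> borel_measurable borel"
        using D1p_continuous[OF w p] c by (auto intro: borel_measurable_continuous_onI)
      show "w x = u x" if "x \<in> signed_support \<mu>" for x
        using a(2)[OF that] by (simp add: w_def)
    qed
    then have "C * ennreal (grad_norm p u) = ennreal (morrey_quotient p \<mu> w)"
      using att eq by (simp add: C_def morrey_quotient_def)
    also have "\<dots> \<le> morrey_seminorm p \<rho> w"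
      unfolding morrey_seminorm_def \<mu> using S by (rule SUP_upper)
    also have "\<dots> \<le> C * ennreal (grad_norm p w)" by (rule bound[OF w])
    \<comment> \<open>Cancelling \<open>C\<close> uses both that it is nonzero and that it is
      finite.\<close>
    finally have "ennreal (grad_norm p u) \<le> ennreal (grad_norm p w)"
      using C_0 C_top by (simp add: ennreal_mult_le_mult_iff)
    moreover have "grad_norm p w \<ge> 0" by (simp add: grad_norm_def)
    ultimately have "grad_norm p u \<le> grad_norm p w" by simp
    \<comment> \<open>The constant difference is evaluated at \<open>a\<close>, where the truncation
      at level \<open>u a\<close> changes nothing; it is therefore 0.\<close>
    then have "u x - max (u x) (u a) = u a - max (u a) (u a)" for x
      unfolding w_def by (rule max_eq_if_grad_norm_le[OF u p])
    then have "u a \<le> u x" for x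
      by (metis diff_self eq_iff_diff_eq_0 max.cobounded2 max.idem)
    with a(1) show ?thesis by blast
  qed
qed

lemma signed_integral_minus: "signed_integral \<mu> (\<lambda>x. - f x) = - signed_integral \<mu> (f :: _ \<Rightarrow> real)"
  by (simp add: signed_integral_def)

theorem proposition4p3:
  fixes p :: real
    and \<rho> \<mu> :: "(real^'n) set \<Rightarrow> real"
    and S :: "real^'n \<Rightarrow> real^'n"
    and u :: "real^'n \<Rightarrow> real"
  assumes "real CARD('n) < p"
    and "admissible_measure \<rho>"
    and "S \<in> similarities"
    and "\<mu> = push_forward S \<rho>"
    and "morrey_extremal p \<rho> u"
    and "morrey_seminorm p \<rho> u = ennreal (morrey_quotient p \<mu> u)"
  shows "(\<exists>a. is_arg_min u (\<lambda>x. x \<in> signed_support \<mu>) a \<and>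
              (INF x. ereal (u x)) = ereal (u a)) \<and>
         (\<exists>b. is_arg_max u (\<lambda>x. x \<in> signed_support \<mu>) b \<and>
              (SUP x. ereal (u x)) = ereal (u b))"
proof -
  obtain a where a: "a \<in> signed_support \<mu>" "\<And>x. u a \<le> u x"
    using extremal_min[OF assms] by blast
  have q: "morrey_quotient p \<nu> (\<lambda>x. - u x) = morrey_quotient p \<nu> u" for \<nu>
    by (simp add: morrey_quotient_def signed_integral_minus)
  then have s: "morrey_seminorm p \<rho> (\<lambda>x. - u x) = morrey_seminorm p \<rho> u"
    by (simp add: morrey_seminorm_def)
  have "morrey_extremal p \<rho> (\<lambda>x. - u x)"
    using assms(5) D1p_minus[of u p] grad_norm_minus[of u p] by (simp add: morrey_extremal_def s)
  moreover have "morrey_seminorm p \<rho> (\<lambda>x. - u x) = ennreal (morrey_quotient p \<mu> (\<lambda>x. - u x))"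
    using assms(6) by (simp add: s q)
  ultimately obtain b where b: "b \<in> signed_support \<mu>" "\<And>x. u x \<le> u b"
    using extremal_min[OF assms(1-4), of "\<lambda>x. - u x"] by auto
  have "is_arg_min u (\<lambda>x. x \<in> signed_support \<mu>) a" "is_arg_max u (\<lambda>x. x \<in> signed_support \<mu>) b"
    using a b by (auto simp: is_arg_min_def is_arg_max_def not_less)
  moreover have "(INF x. ereal (u x)) = ereal (u a)" "(SUP x. ereal (u x)) = ereal (u b)"
    using a b by (auto intro!: antisym INF_greatest SUP_least INF_lower SUP_upper)
  ultimately show ?thesis by blast
qed

end
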